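(* Let $x:[0,+\infty)\to\mathbb{R}$ be a càdlàg path such that $\sum_{0<s\le t}(\Delta x_s)^2<+\infty$ for any $t>0$. Let $\mathcal{X}=(x^{\varepsilon})_{\varepsilon>0}$ be a family of càdlàg paths $x^{\varepsilon}:[0,+\infty)\to\mathbb{R}$ such that, for every $\varepsilon>0$, $\sup_{s\ge 0}|x_s-x_s^{\varepsilon}|\le\varepsilon$ and $x^{\varepsilon}$ has finite total variation on compacts, and such that the limit $$\langle x\rangle_t:=2\lim_{\varepsilon\to 0+}\int_0^t (x_s-x_s^{\varepsilon})\,\mathrm{d}x_s^{\varepsilon},\qquad t\ge 0,$$ exists uniformly on compact sets of $t$. Moreover, assume that for every $t>0$ $$\sup_{\varepsilon>0}\int_0^t|x_s-x_s^{\varepsilon}|\,|\mathrm{d}x_s^{\varepsilon}|<+\infty,$$ and that there exists a constant $K$ such that $|\Delta x_t^{\varepsilon}|\le K|\Delta x_t|$ for any $t>0$ and $\varepsilon>0$. Then for any $f:\mathbb{R}\to\mathbb{R}$ of class $C^1$ and any $t>0$ the limit $$(\mathcal{X})'\int_{0+}^t f(x_{s-})\,\mathrm{d}x_s:=\lim_{\varepsilon\to 0+}\int_{0+}^t f(x_{s-}^{\varepsilon})\,\mathrm{d}x_s$$ exists and the usual Itô formula holds: $$F(x_t)-F(x_0)=(\mathcal{X})'\int_{0+}^t f(x_{s-})\,\mathrm{d}x_s+\frac12\int_{0+}^t f'(x_{s-})\,\mathrm{d}\langle x\rangle_s+\sum_{0<s\le t}\left\{F(x_s)-F(x_{s-})-f(x_{s-})\Delta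 x_s\right\},$$ where $F$ is an antiderivative of $f$.
   Context: $\Delta x_s=x_s-x_{s-}$ for $s>0$, and $\Delta f(x^{\varepsilon}_s)=f(x^{\varepsilon}_s)-f(x^{\varepsilon}_{s-})$. Integrals with respect to $x^{\varepsilon}$, $f(x^{\varepsilon})$ and $\langle x\rangle$ are Lebesgue–Stieltjes integrals, and $|\mathrm{d}x^{\varepsilon}|$ denotes the total variation measure of $\mathrm{d}x^{\varepsilon}$. All integrals $\int_0^t$ and $\int_{0+}^t$ are taken over $(0,t]$. The integral $\int_{0+}^t f(x_{s-}^{\varepsilon})\,\mathrm{d}x_s$ (where $x$ need not have finite variation) is defined by integration by parts: $$\int_{0+}^t f(x_{s-}^{\varepsilon})\,\mathrm{d}x_s:=f(x_t^{\varepsilon})x_t-f(x_0^{\varepsilon})x_0-\int_{0+}^t x_{s-}\,\mathrm{d}f(x_s^{\varepsilon})-\sum_{0<s\le t}\Delta x_s\,\Delta f(x_s^{\varepsilon}),$$ where $\int_{0+}^t x_{s-}\,\mathrm{d}f(x_s^{\varepsilon})$ is the usual Lebesgue–Stieltjes integral (note that $f(x^{\varepsilon})$ has finite total variation on compacts). *)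

theory Defs
  imports "HOL-Analysis.Analysis"
begin

text \<open>
  Paths on \<open>[0, \<infinity>)\<close> are functions of type \<^typ>\<open>real \<Rightarrow> real\<close>; every notion below depends only
  on their values at nonnegative times.
\<close>

definition cadlag :: "(real \<Rightarrow> real) \<Rightarrow> bool" where
  "cadlag g \<longleftrightarrow>
     (\<forall>t\<ge>0. (g \<longlongrightarrow> g t) (at_right t)) \<and> (\<forall>t>0. \<exists>l. (g \<longlongrightarrow> l) (at_left t))"

definition left_lim :: "(real \<Rightarrow> real) \<Rightarrow> real \<Rightarrow> real" where
  "left_lim g t = Lim (at_left t) g"

definition jump :: "(real \<Rightarrow> real) \<Rightarrow> real \<Rightarrow> real" where
  "jump g t = g t - left_lim g t"

definition variation_sums :: "(real \<Rightarrow> real) \<Rightarrow> real \<Rightarrow> real set" where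
  "variation_sums g t =
     {\<Sum>i<n. \<bar>g (p (Suc i)) - g (p i)\<bar> | (p :: nat \<Rightarrow> real) (n :: nat).
        mono_on {..n} p \<and> p ` {..n} \<subseteq> {0..t}}"

definition finite_variation :: "(real \<Rightarrow> real) \<Rightarrow> bool" where
  "finite_variation g \<longleftrightarrow> (\<forall>t\<ge>0. bdd_above (variation_sums g t))"

definition total_variation :: "(real \<Rightarrow> real) \<Rightarrow> real \<Rightarrow> real" where
  "total_variation g t = Sup (variation_sums g t)"

definition pos_variation :: "(real \<Rightarrow> real) \<Rightarrow> real \<Rightarrow> real" where
  "pos_variation g t = (total_variation g t + (g t - g 0)) / 2"

definition neg_variation :: "(real \<Rightarrow> real) \<Rightarrow> real \<Rightarrow> real" where
  "neg_variation g t = (total_variation g t - (g t - g 0)) / 2"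

text \<open>
  \<^const>\<open>interval_measure\<close> is meaningful for nondecreasing right-continuous functions on the whole
  line. The variation functions of a cadlag path of finite variation vanish at \<open>0\<close> and are
  nondecreasing and right-continuous on \<open>[0, \<infinity>)\<close>; freezing the time argument at \<open>0\<close> extends them
  by \<open>0\<close> to negative times.
\<close>

definition stieltjes_measure :: "(real \<Rightarrow> real) \<Rightarrow> real measure" where
  "stieltjes_measure A = interval_measure (\<lambda>s. A (max 0 s))"

text \<open>
  For a cadlag \<open>g\<close> of finite variation on compacts, the Jordan decomposition of the signed measure
  \<open>dg\<close> is given by the positive and negative variations, and \<open>|dg|\<close> is the measure of the total
  variation function.
\<close>

definition tv_measure :: "(real \<Rightarrow> real) \<Rightarrow> real measure" where
  "tv_measure g = stieltjes_measure (total_variation g)"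

definition LS_integrable :: "(real \<Rightarrow> real) \<Rightarrow> (real \<Rightarrow> real) \<Rightarrow> real \<Rightarrow> bool" where
  "LS_integrable h g t \<longleftrightarrow>
     cadlag g \<and> finite_variation g \<and> set_integrable (tv_measure g) {0<..t} h"

definition LS_integral :: "(real \<Rightarrow> real) \<Rightarrow> (real \<Rightarrow> real) \<Rightarrow> real \<Rightarrow> real" where
  "LS_integral h g t =
     set_lebesgue_integral (stieltjes_measure (pos_variation g)) {0<..t} h
   - set_lebesgue_integral (stieltjes_measure (neg_variation g)) {0<..t} h"

definition tv_integral :: "(real \<Rightarrow> real) \<Rightarrow> (real \<Rightarrow> real) \<Rightarrow> real \<Rightarrow> real" where
  "tv_integral h g t = set_lebesgue_integral (tv_measure g) {0<..t} h"

text \<open>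
  \<open>\<integral>\<^bsub>0+\<^esub>\<^bsup>t\<^esup> f(y\<^bsub>s-\<^esub>) dx\<^sub>s\<close> for \<open>y\<close> of finite variation and \<open>x\<close> possibly of infinite variation,
  by integration by parts.
\<close>

definition parts_integral ::
  "(real \<Rightarrow> real) \<Rightarrow> (real \<Rightarrow> real) \<Rightarrow> (real \<Rightarrow> real) \<Rightarrow> real \<Rightarrow> real" where
  "parts_integral f y x t =
     f (y t) * x t - f (y 0) * x 0
   - LS_integral (left_lim x) (\<lambda>s. f (y s)) t
   - (\<Sum>\<^sub>\<infinity>s\<in>{0<..t}. jump x s * (f (y s) - f (left_lim y s)))"

text \<open>
  A family \<open>(x\<^sup>\<epsilon>)\<close>, \<open>\<epsilon> > 0\<close>, is a function \<open>X\<close> with \<open>X \<epsilon> s = x\<^sup>\<epsilon>\<^sub>s\<close>; only its values for \<open>\<epsilon> > 0\<close> matter.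
\<close>

definition path_bracket :: "(real \<Rightarrow> real \<Rightarrow> real) \<Rightarrow> (real \<Rightarrow> real) \<Rightarrow> real \<Rightarrow> real" where
  "path_bracket X x t =
     2 * Lim (at_right 0) (\<lambda>\<epsilon>. LS_integral (\<lambda>s. x s - X \<epsilon> s) (X \<epsilon>) t)"

definition path_integral ::
  "(real \<Rightarrow> real \<Rightarrow> real) \<Rightarrow> (real \<Rightarrow> real) \<Rightarrow> (real \<Rightarrow> real) \<Rightarrow> real \<Rightarrow> real" where
  "path_integral X f x t = Lim (at_right 0) (\<lambda>\<epsilon>. parts_integral f (X \<epsilon>) x t)"

end

theory Submission
  imports Defs
begin

text \<open>
Fix \<open>\<epsilon>\<close>, write \<open>y = x\<^sup>\<epsilon>\<close> and \<open>v = x - y\<close>, and let \<open>q\<^sub>\<phi>(a, b)\<close> be the difference quotient of a \<open>C\<^sup>1\<close>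
function \<open>\<phi>\<close>, which extends continuously to the diagonal by \<open>\<phi>'\<close>. Since the increments of \<open>\<phi>(y)\<close> are
exactly \<open>q\<^sub>\<phi>\<close> times the increments of \<open>y\<close>, Riemann sums give
\<open>\<integral> h d\<phi>(y) = \<integral> h\<^sub>s q\<^sub>\<phi>(y\<^bsub>s-\<^esub>, y\<^sub>s) dy\<^sub>s\<close> (\<open>chain_rule\<close>). Together with integration by parts this turns
the definition of the integral of \<open>f(y\<^bsub>s-\<^esub>)\<close> against \<open>dx\<close> into (\<open>parts_integral_formula\<close>)

\<open>F(y\<^sub>t) - F(y\<^sub>0) + [f(y) v]\<^sub>0\<^sup>t - \<integral> v\<^sub>s q\<^sub>f(y\<^bsub>s-\<^esub>, y\<^sub>s) dy\<^sub>s - \<Sum> {F(y\<^sub>s) - F(y\<^bsub>s-\<^esub>) - f(y\<^bsub>s-\<^esub>) \<Delta>y\<^sub>s}\<close>,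

where the sum is the integral of \<open>q\<^sub>F(y\<^bsub>s-\<^esub>, y\<^sub>s) - f(y\<^bsub>s-\<^esub>)\<close> against \<open>dy\<close>, an integrand that lives on the
jumps of \<open>y\<close> (\<open>has_sum_jumps\<close>).

Now let \<open>\<epsilon>\<close> tend to \<open>0\<close>. As \<open>|v| \<le> \<epsilon>\<close>, the boundary term vanishes and \<open>F(y)\<close> tends to \<open>F(x)\<close>. The
jump sums converge by dominated convergence, since their terms are bounded by a constant times
\<open>(\<Delta>y\<^sub>s)\<^sup>2 \<le> K\<^sup>2 (\<Delta>x\<^sub>s)\<^sup>2\<close>, which is summable. In the integral of \<open>v\<close> one may replace \<open>q\<^sub>f(y\<^bsub>s-\<^esub>, y\<^sub>s)\<close> by
\<open>f'(x\<^bsub>s-\<^esub>)\<close>: only finitely many jumps of \<open>x\<close> are large, and there \<open>v\<close> is small; elsewhere the two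
expressions are uniformly close while \<open>\<integral> |v| |dy|\<close> stays bounded (\<open>remainder_tendsto_0\<close>).
Finally the signed measures \<open>2 v dy\<close> have uniformly bounded mass and their distribution functions
converge to the bracket \<open>\<langle>x\<rangle>\<close>, which therefore is a cadlag path of finite variation (\<open>finite_variation_path_limit\<close>); approximating \<open>f'(x\<^bsub>s-\<^esub>)\<close> uniformly by step functions shows that
\<open>2 \<integral> v\<^sub>s f'(x\<^bsub>s-\<^esub>) dy\<^sub>s\<close> converges to \<open>\<integral> f'(x\<^bsub>s-\<^esub>) d\<langle>x\<rangle>\<^sub>s\<close> (\<open>LS_integral_limit\<close>).
\<close>

section \<open>Total variation\<close>

lemma variation_sum_le_total_variation:
  assumes "finite_variation g" "0 \<le> t" "mono_on {..n} p" "p ` {..n} \<subseteq> {0..t}"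
  shows "(\<Sum>i<n. \<bar>g (p (Suc i)) - g (p i)\<bar>) \<le> total_variation g t"
  unfolding total_variation_def
  by (rule cSup_upper) (use assms in \<open>auto simp: variation_sums_def finite_variation_def\<close>)

lemma variation_sums_nonempty: "0 \<le> t \<Longrightarrow> variation_sums g t \<noteq> {}"
proof -
  assume "0 \<le> t"
  then have "(\<Sum>i<0. \<bar>g ((\<lambda>_. 0) (Suc i)) - g ((\<lambda>_. 0) i)\<bar>) \<in> variation_sums g t"
    unfolding variation_sums_def
    by (intro CollectI exI[of _ "\<lambda>_. 0"] exI[of _ 0]) (auto simp: mono_on_def)
  then show ?thesis by blast
qed

lemma sum_lessThan_add:
  "(\<Sum>i<k + m. f i) = (\<Sum>i<k. f i) + (\<Sum>i<m. f (k + i :: nat) :: real)"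
  by (induction m) (auto simp: add.assoc)

text \<open>A partition of \<open>[0, a]\<close> followed by one of \<open>[a, b]\<close> is a partition of \<open>[0, b]\<close>; the increment of
the joined sequence between its two parts only helps.\<close>

lemma total_variation_superadditive:
  assumes g: "finite_variation g" and ab: "0 \<le> a" "a \<le> b"
    and q: "mono_on {..m} q" "q ` {..m} \<subseteq> {a..b}"
  shows "total_variation g a + (\<Sum>i<m. \<bar>g (q (Suc i)) - g (q i)\<bar>) \<le> total_variation g b"
proof -
  let ?S = "\<Sum>i<m. \<bar>g (q (Suc i)) - g (q i)\<bar>"
  have "total_variation g a \<le> total_variation g b - ?S"
    unfolding total_variation_def[of g a]
  proof (rule cSup_least[OF variation_sums_nonempty[OF ab(1)]])
    fix s assume "s \<in> variation_sums g a"
    then obtain p :: "nat \<Rightarrow> real" and n where p: "mono_on {..n} p" "p ` {..n} \<subseteq> {0..a}"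
      and s: "s = (\<Sum>i<n. \<bar>g (p (Suc i)) - g (p i)\<bar>)"
      by (auto simp: variation_sums_def)
    define r where "r i = (if i \<le> n then p i else q (i - Suc n))" for i
    have pa: "0 \<le> p i" "p i \<le> a" if "i \<le> n" for i
      using p(2) that by (auto simp: image_subset_iff)
    have qb: "a \<le> q i" "q i \<le> b" if "i \<le> m" for i
      using q(2) that by (auto simp: image_subset_iff)
    have "mono_on {..Suc n + m} r"
    proof (rule mono_onI)
      fix i j assume ij: "i \<in> {..Suc n + m}" "j \<in> {..Suc n + m}" "i \<le> j"
      show "r i \<le> r j"
      proof (cases "j \<le> n")
        case True
        then show ?thesis using ij p(1) by (auto simp: r_def mono_on_def)
      next
        case j: False
        show ?thesis
        proof (cases "i \<le> n")
          case True
          have "p i \<le> a" "a \<le> q (j - Suc n)"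
            using pa[OF True] qb[of "j - Suc n"] ij by auto
          then show ?thesis using j True by (simp add: r_def)
        next
          case False
          then have "q (i - Suc n) \<le> q (j - Suc n)"
            using j ij by (intro mono_onD[OF q(1)]) auto
          then show ?thesis using j False by (simp add: r_def)
        qed
      qed
    qed
    moreover have "r ` {..Suc n + m} \<subseteq> {0..b}"
    proof
      fix z assume "z \<in> r ` {..Suc n + m}"
      then obtain i where i: "i \<le> Suc n + m" "z = r i" by auto
      then have "i - Suc n \<le> m" by linarith
      then show "z \<in> {0..b}"
        using pa[of i] qb[of "i - Suc n"] ab i by (cases "i \<le> n") (force simp: r_def)+
    qed
    ultimately have "(\<Sum>i<Suc n + m. \<bar>g (r (Suc i)) - g (r i)\<bar>) \<le> total_variation g b"
      using variation_sum_le_total_variation[OF g, of b] ab by (meson order_trans)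
    moreover have "(\<Sum>i<Suc n + m. \<bar>g (r (Suc i)) - g (r i)\<bar>) =
        (\<Sum>i<Suc n. \<bar>g (r (Suc i)) - g (r i)\<bar>) + ?S"
      by (subst sum_lessThan_add) (simp add: r_def)
    moreover have "(\<Sum>i<Suc n. \<bar>g (r (Suc i)) - g (r i)\<bar>) \<ge> s"
      by (simp add: r_def s)
    ultimately show "s \<le> total_variation g b - ?S" by linarith
  qed
  then show ?thesis by linarith
qed

lemma abs_increment_le_total_variation:
  assumes "finite_variation g" "0 \<le> a" "a \<le> b"
  shows "\<bar>g b - g a\<bar> \<le> total_variation g b - total_variation g a"
proof -
  have "total_variation g a + (\<Sum>i<1. \<bar>g ((\<lambda>i. if i = 0 then a else b) (Suc i))
      - g ((\<lambda>i. if i = 0 then a else b) i)\<bar>) \<le> total_variation g b"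
    by (rule total_variation_superadditive)
       (use assms in \<open>auto simp: mono_on_def\<close>)
  then show ?thesis by simp
qed

text \<open>Clipping a partition at a level \<open>c\<close> from above and from below splits its variation sum, by the
triangle inequality on the single step that crosses \<open>c\<close>. Clipping replaces the insertion of \<open>c\<close> as
a new partition point and leaves the number of points unchanged.\<close>

lemma variation_sum_split:
  fixes p :: "nat \<Rightarrow> real"
  assumes "mono_on {..n} p"
  shows "(\<Sum>i<n. \<bar>g (p (Suc i)) - g (p i)\<bar>) \<le>
    (\<Sum>i<n. \<bar>g (min (p (Suc i)) c) - g (min (p i) c)\<bar>) +
    (\<Sum>i<n. \<bar>g (max (p (Suc i)) c) - g (max (p i) c) :: real\<bar>)"
  unfolding sum.distrib[symmetric]
proof (rule sum_mono)
  fix i assume "i \<in> {..<n}"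
  then have "p i \<le> p (Suc i)" using assms by (auto simp: mono_on_def)
  then show "\<bar>g (p (Suc i)) - g (p i)\<bar> \<le> \<bar>g (min (p (Suc i)) c) - g (min (p i) c)\<bar> +
      \<bar>g (max (p (Suc i)) c) - g (max (p i) c)\<bar>"
    by (auto simp: min_def max_def)
qed

text \<open>A partition of \<open>[0, t + 1]\<close> that nearly attains the variation is split at \<open>t\<close> and at a point \<open>u\<close> that
lies to the right of \<open>t\<close> but before every later partition point. The part in \<open>[0, t]\<close> contributes at
most the total variation \<open>V t\<close>, the part after \<open>u\<close> at most \<open>V (t + 1) - V u\<close>, and the part between them at most
\<open>\<bar>g u - g t\<bar>\<close>, which is small because \<open>g\<close> is right-continuous. Hence \<open>V u\<close> is hardly larger than \<open>V t\<close>.\<close>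

lemma total_variation_right_continuous:
  assumes g: "finite_variation g" "cadlag g" and t: "0 \<le> t"
  shows "(total_variation g \<longlongrightarrow> total_variation g t) (at_right t)"
proof (rule tendstoI)
  fix e :: real assume "e > 0"
  define \<eta> where "\<eta> = e / 3"
  have \<eta>: "\<eta> > 0" using \<open>e > 0\<close> by (simp add: \<eta>_def)
  let ?V = "total_variation g"
  have "?V (t + 1) - \<eta> < Sup (variation_sums g (t + 1))"
    using \<eta> by (simp add: total_variation_def)
  then obtain s where "s \<in> variation_sums g (t + 1)" "?V (t + 1) - \<eta> < s"
    using less_cSupE variation_sums_nonempty t by (metis add_nonneg_nonneg zero_le_one)
  then obtain p :: "nat \<Rightarrow> real" and n where p: "mono_on {..n} p" "p ` {..n} \<subseteq> {0..t + 1}"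
    and s: "?V (t + 1) - \<eta> < (\<Sum>i<n. \<bar>g (p (Suc i)) - g (p i)\<bar>)"
    by (auto simp: variation_sums_def)
  have "(g \<longlongrightarrow> g t) (at_right t)" using g t by (auto simp: cadlag_def)
  then have "\<forall>\<^sub>F u in at_right t. \<bar>g u - g t\<bar> < \<eta>"
    using \<eta> by (auto simp: tendsto_iff dist_real_def)
  moreover have "\<forall>\<^sub>F u in at_right t. u < t + 1"
    by (rule order_tendstoD(2)[OF tendsto_ident_at]) simp
  moreover have "\<forall>\<^sub>F u in at_right t. \<forall>i\<in>{..n}. p i > t \<longrightarrow> u < p i"
    by (rule eventually_ball_finite) (auto intro!: order_tendstoD(2)[OF tendsto_ident_at])
  moreover have "\<forall>\<^sub>F u in at_right t. u > t"
    by (simp add: eventually_at_right_less)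
  ultimately have "\<forall>\<^sub>F u in at_right t. t < u \<and> u < t + 1 \<and> \<bar>g u - g t\<bar> < \<eta> \<and>
      (\<forall>i\<in>{..n}. p i > t \<longrightarrow> u < p i)"
    by eventually_elim auto
  then show "\<forall>\<^sub>F u in at_right t. dist (?V u) (?V t) < e"
  proof eventually_elim
    case (elim u)
    define q where "q i = max (p i) t" for i
    have mono: "mono_on {..n} q" "mono_on {..n} (\<lambda>i. min (p i) t)" "mono_on {..n} (\<lambda>i. max (q i) u)"
      using p(1) unfolding q_def mono_on_def by (auto simp: min_def max_def intro: order_trans)
    have "(\<Sum>i<n. \<bar>g (p (Suc i)) - g (p i)\<bar>) \<le>
       (\<Sum>i<n. \<bar>g (min (p (Suc i)) t) - g (min (p i) t)\<bar>) + (\<Sum>i<n. \<bar>g (q (Suc i)) - g (q i)\<bar>)"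
      unfolding q_def by (rule variation_sum_split[OF p(1)])
    moreover have "(\<Sum>i<n. \<bar>g (q (Suc i)) - g (q i)\<bar>) \<le>
       (\<Sum>i<n. \<bar>g (min (q (Suc i)) u) - g (min (q i) u)\<bar>) +
       (\<Sum>i<n. \<bar>g (max (q (Suc i)) u) - g (max (q i) u)\<bar>)"
      by (rule variation_sum_split[OF mono(1)])
    moreover have "(\<Sum>i<n. \<bar>g (min (p (Suc i)) t) - g (min (p i) t)\<bar>) \<le> ?V t"
      by (rule variation_sum_le_total_variation[OF g(1) t mono(2)])
         (use p(2) t in \<open>auto simp: image_subset_iff\<close>)
    moreover have "?V u + (\<Sum>i<n. \<bar>g (max (q (Suc i)) u) - g (max (q i) u)\<bar>) \<le> ?V (t + 1)"
      by (rule total_variation_superadditive[OF g(1) _ _ mono(3)])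
         (use p(2) t elim in \<open>auto simp: q_def image_subset_iff\<close>)
    moreover have "(\<Sum>i<n. \<bar>g (min (q (Suc i)) u) - g (min (q i) u)\<bar>) \<le> \<bar>g u - g t\<bar>"
    proof -
      \<comment> \<open>No point of the partition lies in \<open>(t, u]\<close>, so the clipped points take only the
        values \<open>t\<close> and \<open>u\<close> and switch at most once: the sum telescopes.\<close>
      define h where "h i = (if p i \<le> t then 0 else \<bar>g u - g t\<bar>)" for i
      have m: "min (q i) u = (if p i \<le> t then t else u)" if "i \<le> n" for i
        using elim that by (auto simp: q_def)
      have "(\<Sum>i<n. \<bar>g (min (q (Suc i)) u) - g (min (q i) u)\<bar>) = (\<Sum>i<n. h (Suc i) - h i)"
      proof (rule sum.cong)
        fix i assume "i \<in> {..<n}"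
        moreover from this have "p i \<le> p (Suc i)" using p(1) by (auto simp: mono_on_def)
        ultimately show "\<bar>g (min (q (Suc i)) u) - g (min (q i) u)\<bar> = h (Suc i) - h i"
          by (auto simp: m h_def)
      qed simp
      also have "\<dots> = h n - h 0" by (rule sum_lessThan_telescope)
      also have "\<dots> \<le> \<bar>g u - g t\<bar>" by (auto simp: h_def)
      finally show ?thesis .
    qed
    moreover have "?V t \<le> ?V u"
      using abs_increment_le_total_variation[OF g(1) t, of u] elim by auto
    ultimately have "?V t \<le> ?V u" "?V u < ?V t + 3 * \<eta>"
      using s elim by auto
    then show ?case by (simp add: dist_real_def \<eta>_def)
  qed
qed

lemma total_variation_0: "total_variation g 0 = 0"
proof -
  have "variation_sums g 0 \<subseteq> {0}"
  proof
    fix s assume "s \<in> variation_sums g 0"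
    then obtain p :: "nat \<Rightarrow> real" and n where p: "p ` {..n} \<subseteq> {0..0}"
      and s: "s = (\<Sum>i<n. \<bar>g (p (Suc i)) - g (p i)\<bar>)"
      by (auto simp: variation_sums_def)
    have "p i = 0" if "i \<le> n" for i using p that by (auto simp: image_subset_iff)
    then show "s \<in> {0}" by (auto simp: s intro!: sum.neutral)
  qed
  then have "variation_sums g 0 = {0}" using variation_sums_nonempty[of 0 g] by auto
  then show ?thesis by (simp add: total_variation_def)
qed

text \<open>
The conditions on the half line \<open>[0, \<infinity>)\<close> under which \<^const>\<open>stieltjes_measure\<close> gives \<open>(a, b]\<close> the
mass \<open>A b - A a\<close>.
\<close>

definition nondecreasing_rc :: "(real \<Rightarrow> real) \<Rightarrow> bool" where
  "nondecreasing_rc A \<longleftrightarrow> mono_on {0..} A \<and> (\<forall>t\<ge>0. (A \<longlongrightarrow> A t) (at_right t))"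

lemma nondecreasing_rc_variations:
  assumes g: "finite_variation g" "cadlag g"
  shows "nondecreasing_rc (total_variation g)"
    and "nondecreasing_rc (pos_variation g)"
    and "nondecreasing_rc (neg_variation g)"
proof -
  note inc = abs_increment_le_total_variation[OF g(1)]
  note rc = total_variation_right_continuous[OF g]
  have g_rc: "(g \<longlongrightarrow> g t) (at_right t)" if "0 \<le> t" for t
    using g(2) that by (auto simp: cadlag_def)
  show "nondecreasing_rc (total_variation g)"
    unfolding nondecreasing_rc_def using rc by (auto intro!: mono_onI dest: inc)
  show "nondecreasing_rc (pos_variation g)"
    unfolding nondecreasing_rc_def pos_variation_def
    by (auto intro!: mono_onI tendsto_intros rc g_rc dest: inc)
  show "nondecreasing_rc (neg_variation g)"
    unfolding nondecreasing_rc_def neg_variation_def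
    by (auto intro!: mono_onI tendsto_intros rc g_rc dest: inc)
qed

section \<open>Stieltjes measures\<close>

definition stieltjes_integral :: "(real \<Rightarrow> real) \<Rightarrow> (real \<Rightarrow> real) \<Rightarrow> real \<Rightarrow> real" where
  "stieltjes_integral h A t = set_lebesgue_integral (stieltjes_measure A) {0<..t} h"

lemma sets_stieltjes_measure [simp, measurable_cong]: "sets (stieltjes_measure A) = sets borel"
  by (simp add: stieltjes_measure_def)

lemma space_stieltjes_measure [simp]: "space (stieltjes_measure A) = UNIV"
  by (simp add: stieltjes_measure_def)

lemma emeasure_stieltjes_measure_Ioc:
  assumes A: "nondecreasing_rc A" and "a \<le> b"
  shows "emeasure (stieltjes_measure A) {a<..b} = ennreal (A (max 0 b) - A (max 0 a))"
  unfolding stieltjes_measure_def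
proof (rule emeasure_interval_measure_Ioc[OF \<open>a \<le> b\<close>])
  show "A (max 0 x) \<le> A (max 0 y)" if "x \<le> y" for x y
    using A that by (auto simp: nondecreasing_rc_def intro!: mono_onD[of "{0..}" A])
  show "continuous (at_right x) (\<lambda>s. A (max 0 s))" for x
  proof (cases "x \<ge> 0")
    case True
    have "(A \<longlongrightarrow> A x) (at_right x)" using A True by (auto simp: nondecreasing_rc_def)
    moreover have "\<forall>\<^sub>F s in at_right x. A s = A (max 0 s)"
      using eventually_at_right_less[of x] by eventually_elim (use True in auto)
    ultimately show ?thesis
      using True by (auto simp: continuous_within intro: Lim_transform_eventually)
  next
    case False
    have "\<forall>\<^sub>F s in at_right x. s < 0"
      using False by (intro order_tendstoD(2)[OF tendsto_ident_at]) simp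
    then have "\<forall>\<^sub>F s in at_right x. A 0 = A (max 0 s)"
      by eventually_elim auto
    then show ?thesis
      using False by (auto simp: continuous_within intro: Lim_transform_eventually[OF tendsto_const])
  qed
qed

lemma borel_measurable_stieltjes_measure [simp]:
  "borel_measurable (stieltjes_measure A) = borel_measurable borel"
  by (rule measurable_cong_sets) simp_all

lemma nondecreasing_rc_add:
  assumes "nondecreasing_rc A" "nondecreasing_rc B"
  shows "nondecreasing_rc (\<lambda>s. A s + B s)"
  using assms unfolding nondecreasing_rc_def
  by (simp add: mono_on_def add_mono tendsto_add)

text \<open>Both sides are measures in \<open>X\<close> that agree on half-open intervals. For the Jordan decomposition this
says that \<open>|dg|\<close> is the sum of the positive and the negative part of \<open>dg\<close>, which is what bounds an
integral against \<open>dg\<close> by the integral of the absolute value against \<open>|dg|\<close>.\<close>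

lemma emeasure_stieltjes_measure_add:
  assumes A: "nondecreasing_rc A" and B: "nondecreasing_rc B" and X: "X \<in> sets borel"
  shows "emeasure (stieltjes_measure (\<lambda>s. A s + B s)) X =
    emeasure (stieltjes_measure A) X + emeasure (stieltjes_measure B) X"
proof -
  define \<mu> where "\<mu> X = emeasure (stieltjes_measure A) X + emeasure (stieltjes_measure B) X" for X
  define M where "M = measure_of UNIV (sets borel) \<mu>"
  have sets_M: "sets M = sets borel"
    by (simp add: M_def) (metis sets.sigma_sets_eq space_borel)
  have em: "emeasure M X = \<mu> X" if "X \<in> sets borel" for X
  proof (rule emeasure_measure_of[OF M_def])
    show "countably_additive (sets M) \<mu>"
    proof (rule countably_additiveI)
      fix E :: "nat \<Rightarrow> real set"
      assume E: "range E \<subseteq> sets M" "disjoint_family E"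
      have r: "range E \<subseteq> sets (stieltjes_measure A)" "range E \<subseteq> sets (stieltjes_measure B)"
        using E by (auto simp: sets_M)
      show "(\<Sum>i. \<mu> (E i)) = \<mu> (\<Union> (range E))"
        unfolding \<mu>_def
        by (subst suminf_add[symmetric]) (simp_all add: suminf_emeasure[OF r(1) E(2)]
          suminf_emeasure[OF r(2) E(2)])
    qed
  qed (use that in \<open>auto simp: sets_M positive_def \<mu>_def\<close>)
  have mono: "A (max 0 a) \<le> A (max 0 b)" "B (max 0 a) \<le> B (max 0 b)" if "a \<le> b" for a b
    using A B that by (simp_all add: nondecreasing_rc_def mono_on_def)
  have AB: "nondecreasing_rc (\<lambda>s. A s + B s)"
    using A B by (rule nondecreasing_rc_add)
  have "stieltjes_measure (\<lambda>s. A s + B s) = M"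
  proof (rule measure_eqI_generator_eq[where E = "range (\<lambda>(a, b). {a<..b::real})" and \<Omega> = UNIV
        and A = "\<lambda>i. {- real i<..real i}"])
    show "Int_stable (range (\<lambda>(a, b). {a<..b::real}))"
    proof (rule Int_stableI)
      fix X Y assume "X \<in> range (\<lambda>(a, b). {a<..b::real})" "Y \<in> range (\<lambda>(a, b). {a<..b::real})"
      then obtain ab cd where "X = (\<lambda>(a, b). {a<..b}) ab" "Y = (\<lambda>(a, b). {a<..b}) cd" by blast
      then obtain a b c d where "X = {a<..b}" "Y = {c<..d}" by (cases ab; cases cd) simp
      then have "X \<inter> Y = (\<lambda>(a, b). {a<..b}) (max a c, min b d)" by auto
      then show "X \<inter> Y \<in> range (\<lambda>(a, b). {a<..b::real})" by blast
    qed
    show "(\<Union>i. {- real i<..real i}) = UNIV"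
    proof (intro set_eqI iffI UNIV_I)
      fix z :: real
      obtain i where "real i > \<bar>z\<bar>" using reals_Archimedean2 by blast
      then show "z \<in> (\<Union>i. {- real i<..real i})" by (intro UN_I[of i]) auto
    qed
    show "emeasure (stieltjes_measure (\<lambda>s. A s + B s)) X = emeasure M X"
      if *: "X \<in> range (\<lambda>(a, b). {a<..b::real})" for X
    proof -
      obtain ab where "X = (\<lambda>(a, b). {a<..b}) ab" using * by (elim rangeE)
      then obtain a b where X: "X = {a<..b}" by (cases ab) simp
      show ?thesis
      proof (cases "a \<le> b")
        case True
        then show ?thesis
          using mono[OF True] by (simp add: X em \<mu>_def emeasure_stieltjes_measure_Ioc A B AB
              flip: ennreal_plus)
      qed (simp add: X)
    qed
    show "range (\<lambda>i. {- real i<..real i}) \<subseteq> range (\<lambda>(a, b). {a<..b::real})"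
      by (rule image_subsetI) (rule image_eqI[where x = "(- real _, real _)"], simp_all)
    show "emeasure (stieltjes_measure (\<lambda>s. A s + B s)) {- real i<..real i} \<noteq> \<infinity>" for i
      by (simp add: emeasure_stieltjes_measure_Ioc[OF AB])
    show "sets (stieltjes_measure (\<lambda>s. A s + B s)) = sigma_sets UNIV (range (\<lambda>(a, b). {a<..b}))"
      "sets M = sigma_sets UNIV (range (\<lambda>(a, b). {a<..b}))"
      by (simp_all add: sets_M borel_sigma_sets_Ioc)
  qed simp
  then show ?thesis using em[OF X] by (simp add: \<mu>_def)
qed

lemma nn_integral_stieltjes_measure_add:
  assumes A: "nondecreasing_rc A" and B: "nondecreasing_rc B"
    and h: "h \<in> borel_measurable (borel :: real measure)"
  shows "(\<integral>\<^sup>+ s. h s \<partial>stieltjes_measure (\<lambda>s. A s + B s)) =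
    (\<integral>\<^sup>+ s. h s \<partial>stieltjes_measure A) + (\<integral>\<^sup>+ s. h s \<partial>stieltjes_measure B)"
  using h
proof (induction rule: borel_measurable_induct)
  case (cong f g)
  then have "f = g" by auto
  then show ?case using cong by simp
next
  case (set X)
  then show ?case by (simp add: emeasure_stieltjes_measure_add[OF A B])
next
  case (mult u c)
  then show ?case by (simp add: nn_integral_cmult distrib_left)
next
  case (add u v)
  then show ?case by (simp add: nn_integral_add algebra_simps)
next
  case (seq U)
  have "(\<integral>\<^sup>+ s. (SUP i. U i s) \<partial>stieltjes_measure (\<lambda>s. A s + B s)) =
      (SUP i. (\<integral>\<^sup>+ s. U i s \<partial>stieltjes_measure A) + (\<integral>\<^sup>+ s. U i s \<partial>stieltjes_measure B))"
    using seq by (subst nn_integral_monotone_convergence_SUP) auto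
  also have "\<dots> = (SUP i. \<integral>\<^sup>+ s. U i s \<partial>stieltjes_measure A) +
      (SUP i. \<integral>\<^sup>+ s. U i s \<partial>stieltjes_measure B)"
    using seq by (intro ennreal_SUP_add)
      (auto simp: incseq_def le_fun_def intro!: nn_integral_mono)
  also have "\<dots> = (\<integral>\<^sup>+ s. (SUP i. U i s) \<partial>stieltjes_measure A) +
      (\<integral>\<^sup>+ s. (SUP i. U i s) \<partial>stieltjes_measure B)"
    using seq by (simp add: nn_integral_monotone_convergence_SUP)
  finally show ?case unfolding SUP_apply .
qed

text \<open>All integrands of the proof are bounded and measurable on \<open>(0, t]\<close>. Their values elsewhere are
arbitrary: a path is unrestricted at negative times, and so is a left limit at \<open>0\<close>.\<close>

definition bounded_borel :: "real \<Rightarrow> (real \<Rightarrow> real) \<Rightarrow> bool" where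
  "bounded_borel t h \<longleftrightarrow>
     (\<exists>C. \<forall>s\<in>{0<..t}. \<bar>h s\<bar> \<le> C) \<and> (\<lambda>s. indicator {0<..t} s * h s) \<in> borel_measurable borel"

lemma bounded_borelE:
  assumes "bounded_borel t h"
  obtains C where "C \<ge> 0" "\<And>s. s \<in> {0<..t} \<Longrightarrow> \<bar>h s\<bar> \<le> C"
proof -
  obtain C where "\<forall>s\<in>{0<..t}. \<bar>h s\<bar> \<le> C" using assms by (auto simp: bounded_borel_def)
  then show ?thesis by (intro that[of "max C 0"]) force+
qed

lemma bounded_borelI:
  "(\<And>s. s \<in> {0<..t} \<Longrightarrow> \<bar>h s\<bar> \<le> C) \<Longrightarrow> (\<lambda>s. indicator {0<..t} s * h s) \<in> borel_measurable borel \<Longrightarrow>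
    bounded_borel t h"
  unfolding bounded_borel_def by blast

lemma bounded_borel_measurable: "h \<in> borel_measurable borel \<Longrightarrow> (\<And>s. \<bar>h s\<bar> \<le> C) \<Longrightarrow> bounded_borel t h"
  by (auto simp: bounded_borel_def)

lemma bounded_borel_const [simp]: "bounded_borel t (\<lambda>_. c)"
  by (rule bounded_borel_measurable[where C = "\<bar>c\<bar>"]) auto

lemma bounded_borel_indicator: "X \<in> sets borel \<Longrightarrow> bounded_borel t (indicator X)"
  by (rule bounded_borel_measurable[where C = 1]) (auto simp: indicator_def)

lemma bounded_borel_add:
  assumes "bounded_borel t h" "bounded_borel t k"
  shows "bounded_borel t (\<lambda>s. h s + k s)"
proof -
  obtain C where C: "\<And>s. s \<in> {0<..t} \<Longrightarrow> \<bar>h s\<bar> \<le> C" using assms(1) by (rule bounded_borelE) (rule that)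
  obtain D where D: "\<And>s. s \<in> {0<..t} \<Longrightarrow> \<bar>k s\<bar> \<le> D" using assms(2) by (rule bounded_borelE) (rule that)
  have "\<bar>h s + k s\<bar> \<le> C + D" if "s \<in> {0<..t}" for s using C[OF that] D[OF that] by linarith
  moreover have "(\<lambda>s. indicator {0<..t} s * h s + indicator {0<..t} s * k s) \<in> borel_measurable borel"
    using assms by (auto simp: bounded_borel_def)
  ultimately show ?thesis by (intro bounded_borelI) (auto simp: distrib_left)
qed

lemma bounded_borel_mult:
  assumes "bounded_borel t h" "bounded_borel t k"
  shows "bounded_borel t (\<lambda>s. h s * k s)"
proof -
  obtain C where C: "C \<ge> 0" "\<And>s. s \<in> {0<..t} \<Longrightarrow> \<bar>h s\<bar> \<le> C" using assms(1) by (rule bounded_borelE) (rule that)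
  obtain D where D: "\<And>s. s \<in> {0<..t} \<Longrightarrow> \<bar>k s\<bar> \<le> D" using assms(2) by (rule bounded_borelE) (rule that)
  have "\<bar>h s * k s\<bar> \<le> C * D" if "s \<in> {0<..t}" for s
    unfolding abs_mult by (rule mult_mono[OF C(2)[OF that] D[OF that] C(1) abs_ge_zero])
  moreover have "(\<lambda>s. (indicator {0<..t} s * h s) * (indicator {0<..t} s * k s)) \<in> borel_measurable borel"
    by (rule borel_measurable_times) (use assms in \<open>simp_all add: bounded_borel_def\<close>)
  moreover have "(\<lambda>s. (indicator {0<..t} s * h s) * (indicator {0<..t} s * k s)) =
      (\<lambda>s. indicator {0<..t} s * (h s * k s))"
    by (intro ext) (simp add: indicator_def)
  ultimately show ?thesis by (intro bounded_borelI) auto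
qed

lemma bounded_borel_uminus: "bounded_borel t h \<Longrightarrow> bounded_borel t (\<lambda>s. - h s)"
  using bounded_borel_mult[OF bounded_borel_const, of t h "-1"] by simp

lemma bounded_borel_diff:
  "bounded_borel t h \<Longrightarrow> bounded_borel t k \<Longrightarrow> bounded_borel t (\<lambda>s. h s - k s)"
  using bounded_borel_add[OF _ bounded_borel_uminus] by fastforce

lemma bounded_borel_abs:
  assumes "bounded_borel t h"
  shows "bounded_borel t (\<lambda>s. \<bar>h s\<bar>)"
proof -
  have "(\<lambda>s. \<bar>indicator {0<..t} s * h s\<bar>) \<in> borel_measurable borel"
    using assms by (auto simp: bounded_borel_def)
  then show ?thesis using assms by (auto simp: bounded_borel_def abs_mult)
qed

lemma bounded_borel_sum:
  "finite I \<Longrightarrow> (\<And>i. i \<in> I \<Longrightarrow> bounded_borel t (h i)) \<Longrightarrow> bounded_borel t (\<lambda>s. \<Sum>i\<in>I. h i s)"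
  by (induction rule: finite_induct) (auto intro: bounded_borel_add)

lemma bounded_borel_cong:
  assumes "\<And>s. s \<in> {0<..t} \<Longrightarrow> h s = k s"
  shows "bounded_borel t h \<longleftrightarrow> bounded_borel t k"
proof -
  have "(\<lambda>s. indicator {0<..t} s * h s) = (\<lambda>s. indicator {0<..t} s * k s)"
    using assms by (auto simp: indicator_def)
  then show ?thesis using assms by (simp add: bounded_borel_def)
qed

lemmas bounded_borel_intros = bounded_borel_const bounded_borel_add bounded_borel_diff
  bounded_borel_mult bounded_borel_uminus bounded_borel_abs

lemma set_integrable_stieltjes:
  assumes A: "nondecreasing_rc A" and h: "bounded_borel t h" and t: "0 \<le> t"
  shows "set_integrable (stieltjes_measure A) {0<..t} h"
proof -
  obtain C where C: "\<And>s. s \<in> {0<..t} \<Longrightarrow> \<bar>h s\<bar> \<le> C" using h by (rule bounded_borelE) (rule that)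
  show ?thesis
    unfolding set_integrable_def
  proof (rule integrableI_bounded_set[where A = "{0<..t}" and B = C])
    show "(\<lambda>s. indicator {0<..t} s *\<^sub>R h s) \<in> borel_measurable (stieltjes_measure A)"
      using h by (simp add: bounded_borel_def)
    show "emeasure (stieltjes_measure A) {0<..t} < \<infinity>"
      by (simp add: emeasure_stieltjes_measure_Ioc[OF A t])
    show "AE s in stieltjes_measure A. s \<in> {0<..t} \<longrightarrow> norm (indicator {0<..t} s *\<^sub>R h s) \<le> C"
      using C by (intro AE_I2) simp
    show "AE s in stieltjes_measure A. s \<notin> {0<..t} \<longrightarrow> indicator {0<..t} s *\<^sub>R h s = 0"
      by (intro AE_I2) simp
  qed simp
qed

lemma stieltjes_integral_linear:
  assumes "nondecreasing_rc A" "bounded_borel t h" "bounded_borel t k" "0 \<le> t"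
  shows stieltjes_integral_add:
      "stieltjes_integral (\<lambda>s. h s + k s) A t = stieltjes_integral h A t + stieltjes_integral k A t"
    and stieltjes_integral_diff:
      "stieltjes_integral (\<lambda>s. h s - k s) A t = stieltjes_integral h A t - stieltjes_integral k A t"
  using set_integral_add[OF set_integrable_stieltjes set_integrable_stieltjes]
    set_integral_diff[OF set_integrable_stieltjes set_integrable_stieltjes] assms
  by (auto simp: stieltjes_integral_def)

lemma stieltjes_integral_mono:
  assumes "nondecreasing_rc A" "bounded_borel t h" "bounded_borel t k" "0 \<le> t"
    and "\<And>s. s \<in> {0<..t} \<Longrightarrow> h s \<le> k s"
  shows "stieltjes_integral h A t \<le> stieltjes_integral k A t"
  unfolding stieltjes_integral_def
  by (rule set_integral_mono[OF set_integrable_stieltjes set_integrable_stieltjes]) (use assms in auto)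

lemma abs_stieltjes_integral_le:
  assumes "nondecreasing_rc A" "bounded_borel t h" "0 \<le> t"
  shows "\<bar>stieltjes_integral h A t\<bar> \<le> stieltjes_integral (\<lambda>s. \<bar>h s\<bar>) A t"
proof -
  have "stieltjes_integral h A t \<le> stieltjes_integral (\<lambda>s. \<bar>h s\<bar>) A t"
    "stieltjes_integral (\<lambda>s. 0 - h s) A t \<le> stieltjes_integral (\<lambda>s. \<bar>h s\<bar>) A t"
    by (intro stieltjes_integral_mono assms bounded_borel_intros; auto)+
  moreover have "stieltjes_integral (\<lambda>s. 0 - h s) A t = - stieltjes_integral h A t"
    by (simp add: stieltjes_integral_def set_lebesgue_integral_def)
  ultimately show ?thesis by linarith
qed

lemma stieltjes_integral_Ioc:
  assumes A: "nondecreasing_rc A" and "0 \<le> a" "a \<le> b" "b \<le> t"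
  shows "stieltjes_integral (indicator {a<..b}) A t = A b - A a"
proof -
  have "(\<lambda>s. indicator {0<..t} s *\<^sub>R indicator {a<..b} s :: real) = indicator {a<..b}"
    using assms by (auto simp: indicator_def)
  moreover have "A a \<le> A b" using A assms by (auto simp: nondecreasing_rc_def mono_on_def)
  ultimately show ?thesis
    using assms emeasure_stieltjes_measure_Ioc[OF A \<open>a \<le> b\<close>]
    by (simp add: stieltjes_integral_def set_lebesgue_integral_def measure_def max_def)
qed

lemma stieltjes_integral_measure_add:
  assumes A: "nondecreasing_rc A" and B: "nondecreasing_rc B"
    and h: "bounded_borel t h" and nonneg: "\<And>s. s \<in> {0<..t} \<Longrightarrow> 0 \<le> h s" and t: "0 \<le> t"
  shows "stieltjes_integral h (\<lambda>s. A s + B s) t = stieltjes_integral h A t + stieltjes_integral h B t"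
proof -
  have AB: "nondecreasing_rc (\<lambda>s. A s + B s)"
    using A B by (rule nondecreasing_rc_add)
  let ?h = "\<lambda>s. indicator {0<..t} s * h s"
  have 0: "0 \<le> ?h s" for s using nonneg by (auto simp: indicator_def)
  have nn: "ennreal (stieltjes_integral h C t) = (\<integral>\<^sup>+ s. ennreal (?h s) \<partial>stieltjes_measure C)"
    if "nondecreasing_rc C" for C
    using set_integrable_stieltjes[OF that h t] 0
    by (subst nn_integral_eq_integral)
       (auto simp: stieltjes_integral_def set_lebesgue_integral_def set_integrable_def)
  have pos: "0 \<le> stieltjes_integral h C t" for C
    unfolding stieltjes_integral_def set_lebesgue_integral_def
    by (rule integral_nonneg_AE) (use 0 in auto)
  have "ennreal (stieltjes_integral h (\<lambda>s. A s + B s) t) =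
      ennreal (stieltjes_integral h A t + stieltjes_integral h B t)"
    unfolding nn[OF AB]
    by (subst nn_integral_stieltjes_measure_add[OF A B])
       (use h in \<open>auto simp: bounded_borel_def nn[OF A, symmetric] nn[OF B, symmetric] pos\<close>)
  then show ?thesis using pos by (simp add: ennreal_inj add_nonneg_nonneg del: ennreal_plus)
qed

lemma stieltjes_integral_dominated_convergence:
  assumes A: "nondecreasing_rc A" and h: "\<And>n. bounded_borel t (h n)" and t: "0 \<le> t"
    and bound: "\<And>n s. s \<in> {0<..t} \<Longrightarrow> \<bar>h n s\<bar> \<le> C"
    and lim: "\<And>s. s \<in> {0<..t} \<Longrightarrow> (\<lambda>n. h n s) \<longlonglongrightarrow> k s"
    and k: "bounded_borel t k"
  shows "(\<lambda>n. stieltjes_integral (h n) A t) \<longlonglongrightarrow> stieltjes_integral k A t"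
  unfolding stieltjes_integral_def set_lebesgue_integral_def
proof (rule integral_dominated_convergence[where w = "\<lambda>s. indicator {0<..t} s *\<^sub>R C"])
  show "integrable (stieltjes_measure A) (\<lambda>s. indicator {0<..t} s *\<^sub>R C)"
    using set_integrable_stieltjes[OF A bounded_borel_const t] by (simp add: set_integrable_def)
qed (use k h bound lim in \<open>auto simp: bounded_borel_def indicator_def\<close>)

lemma bounded_borel_limit:
  assumes h: "\<And>n. bounded_borel t (h n)"
    and bound: "\<And>n s. s \<in> {0<..t} \<Longrightarrow> \<bar>h n s\<bar> \<le> C"
    and lim: "\<And>s. s \<in> {0<..t} \<Longrightarrow> (\<lambda>n. h n s) \<longlonglongrightarrow> k s"
  shows "bounded_borel t k"
proof -
  have "\<bar>k s\<bar> \<le> C" if "s \<in> {0<..t}" for s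
    using lim[OF that] bound[OF that]
    by (intro tendsto_upperbound[OF tendsto_rabs[OF lim[OF that]]]) auto
  moreover have "(\<lambda>s. indicator {0<..t} s * k s) \<in> borel_measurable borel"
  proof (rule borel_measurable_LIMSEQ_real)
    show "(\<lambda>n. indicator {0<..t} s * h n s) \<longlonglongrightarrow> indicator {0<..t} s * k s" for s
      using lim by (auto simp: indicator_def)
    show "(\<lambda>s. indicator {0<..t} s * h n s) \<in> borel_measurable borel" for n
      using h[of n] by (simp add: bounded_borel_def)
  qed
  ultimately show ?thesis by (intro bounded_borelI)
qed

section \<open>Integrals against paths of finite variation\<close>

lemma LS_integral_eq:
  "LS_integral h g t = stieltjes_integral h (pos_variation g) t - stieltjes_integral h (neg_variation g) t"
  by (simp add: LS_integral_def stieltjes_integral_def)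

lemma tv_integral_eq: "tv_integral h g t = stieltjes_integral h (total_variation g) t"
  by (simp add: tv_integral_def tv_measure_def stieltjes_integral_def)

lemma left_lim_tendsto: "cadlag g \<Longrightarrow> 0 < s \<Longrightarrow> (g \<longlongrightarrow> left_lim g s) (at_left s)"
  unfolding cadlag_def left_lim_def using tendsto_Lim[OF trivial_limit_at_left_real] by metis

locale finite_variation_path =
  fixes g :: "real \<Rightarrow> real"
  assumes cadlag: "cadlag g" and finite_variation: "finite_variation g"
begin

lemmas rc = nondecreasing_rc_variations[OF finite_variation cadlag]

lemma LS_integral_linear:
  assumes "bounded_borel t h" "bounded_borel t k" "0 \<le> t"
  shows LS_integral_add: "LS_integral (\<lambda>s. h s + k s) g t = LS_integral h g t + LS_integral k g t"
    and LS_integral_diff: "LS_integral (\<lambda>s. h s - k s) g t = LS_integral h g t - LS_integral k g t"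
  using assms rc by (simp_all add: LS_integral_eq stieltjes_integral_linear)

lemma tv_integral_mono:
  assumes "bounded_borel t h" "bounded_borel t k" "0 \<le> t" "\<And>s. s \<in> {0<..t} \<Longrightarrow> h s \<le> k s"
  shows "tv_integral h g t \<le> tv_integral k g t"
  unfolding tv_integral_eq by (rule stieltjes_integral_mono[OF rc(1)]) (use assms in auto)

lemma tv_integral_add:
  assumes "bounded_borel t h" "bounded_borel t k" "0 \<le> t"
  shows "tv_integral (\<lambda>s. h s + k s) g t = tv_integral h g t + tv_integral k g t"
  using assms rc by (simp add: tv_integral_eq stieltjes_integral_add)

lemma abs_LS_integral_le:
  assumes "bounded_borel t h" "0 \<le> t"
  shows "\<bar>LS_integral h g t\<bar> \<le> tv_integral (\<lambda>s. \<bar>h s\<bar>) g t"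
proof -
  have "total_variation g = (\<lambda>s. pos_variation g s + neg_variation g s)"
    by (auto simp: pos_variation_def neg_variation_def field_simps)
  then have "tv_integral (\<lambda>s. \<bar>h s\<bar>) g t =
      stieltjes_integral (\<lambda>s. \<bar>h s\<bar>) (pos_variation g) t + stieltjes_integral (\<lambda>s. \<bar>h s\<bar>) (neg_variation g) t"
    unfolding tv_integral_eq using assms
    by (simp add: stieltjes_integral_measure_add[OF rc(2,3)] bounded_borel_abs)
  then show ?thesis
    using abs_stieltjes_integral_le[OF rc(2) assms] abs_stieltjes_integral_le[OF rc(3) assms]
    unfolding LS_integral_eq by linarith
qed

lemma LS_integral_dominated_convergence:
  assumes "\<And>n. bounded_borel t (h n)" "0 \<le> t"
    and "\<And>n s. s \<in> {0<..t} \<Longrightarrow> \<bar>h n s\<bar> \<le> C"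
    and "\<And>s. s \<in> {0<..t} \<Longrightarrow> (\<lambda>n. h n s) \<longlonglongrightarrow> k s"
  shows "(\<lambda>n. LS_integral (h n) g t) \<longlonglongrightarrow> LS_integral k g t"
  unfolding LS_integral_eq
  by (intro tendsto_diff stieltjes_integral_dominated_convergence[where C = C] rc
      bounded_borel_limit[of t h C k] assms)

lemma LS_integral_Ioc:
  assumes "0 \<le> a" "a \<le> b" "b \<le> t"
  shows "LS_integral (indicator {a<..b}) g t = g b - g a"
  using assms unfolding LS_integral_eq
  by (simp add: stieltjes_integral_Ioc[OF rc(2)] stieltjes_integral_Ioc[OF rc(3)])
     (simp add: pos_variation_def neg_variation_def field_simps)

text \<open>The intervals \<open>(a n, s]\<close> with \<open>a n\<close> increasing to \<open>s\<close> shrink to \<open>{s}\<close>, and their mass \<open>g s - g (a n)\<close>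
tends to the jump of \<open>g\<close> at \<open>s\<close>.\<close>

lemma LS_integral_singleton:
  assumes s: "0 < s" "s \<le> t"
  shows "LS_integral (indicator {s}) g t = jump g s"
proof -
  define a where "a n = s - s / real (Suc n)" for n
  have a: "0 \<le> a n" "a n < s" for n
    using s by (auto simp: a_def field_simps)
  have "(\<lambda>n. s - s * inverse (real (Suc n))) \<longlonglongrightarrow> s - s * 0"
    by (intro tendsto_intros LIMSEQ_inverse_real_of_nat)
  then have lim: "a \<longlonglongrightarrow> s" by (simp add: a_def[abs_def] divide_inverse)
  then have "filterlim a (at_left s) sequentially"
    using a(2) unfolding filterlim_at
    by (auto intro!: always_eventually dest: less_imp_neq simp: less_imp_neq)
  then have "(\<lambda>n. g (a n)) \<longlonglongrightarrow> left_lim g s"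
    using left_lim_tendsto[OF cadlag s(1)] by (rule filterlim_compose[rotated])
  then have "(\<lambda>n. g s - g (a n)) \<longlonglongrightarrow> jump g s"
    unfolding jump_def by (intro tendsto_intros)
  moreover have "(\<lambda>n. LS_integral (indicator {a n<..s}) g t) \<longlonglongrightarrow> LS_integral (indicator {s}) g t"
  proof (rule LS_integral_dominated_convergence[where C = 1])
    show "(\<lambda>n. indicator {a n<..s} u) \<longlonglongrightarrow> (indicator {s} u :: real)" for u
    proof (rule tendsto_eventually)
      have "\<forall>\<^sub>F n in sequentially. u < s \<longrightarrow> u < a n"
        using order_tendstoD(1)[OF lim, of u] by (cases "u < s") auto
      then show "\<forall>\<^sub>F n in sequentially. indicator {a n<..s} u = (indicator {s} u :: real)"
        by eventually_elim (use a in \<open>auto simp: indicator_def\<close>)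
    qed
  qed (use s in \<open>auto simp: bounded_borel_indicator indicator_def\<close>)
  moreover have "LS_integral (indicator {a n<..s}) g t = g s - g (a n)" for n
    by (rule LS_integral_Ioc) (use a[of n] s in auto)
  ultimately show ?thesis
    using LIMSEQ_unique by auto
qed

lemma tv_integral_const:
  assumes "0 \<le> t"
  shows "tv_integral (\<lambda>_. c) g t = c * total_variation g t"
proof -
  have "tv_integral (\<lambda>_. c) g t = tv_integral (\<lambda>s. c * indicator {0<..t} s) g t"
    unfolding tv_integral_def set_lebesgue_integral_def
    by (rule Bochner_Integration.integral_cong) (auto simp: indicator_def)
  then have "tv_integral (\<lambda>_. c) g t = c * tv_integral (indicator {0<..t}) g t"
    by (simp add: tv_integral_def)
  then show ?thesis
    using assms stieltjes_integral_Ioc[OF rc(1), of 0 t t] by (simp add: tv_integral_eq total_variation_0)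
qed

end

lemma LS_integral_mult_left: "LS_integral (\<lambda>s. c * h s) g t = c * LS_integral h g t"
  by (simp add: LS_integral_def right_diff_distrib)

lemma tv_integral_mult_left: "tv_integral (\<lambda>s. c * h s) g t = c * tv_integral h g t"
  by (simp add: tv_integral_def)

lemma LS_integral_cong: "(\<And>s. s \<in> {0<..t} \<Longrightarrow> h s = k s) \<Longrightarrow> LS_integral h g t = LS_integral k g t"
  unfolding LS_integral_def
  by (auto intro!: arg_cong2[where f = "(-)"] set_lebesgue_integral_cong)

lemma (in finite_variation_path) LS_integral_sum:
  assumes "finite I" "\<And>i. i \<in> I \<Longrightarrow> bounded_borel t (h i)" "0 \<le> t"
  shows "LS_integral (\<lambda>s. \<Sum>i\<in>I. c i * h i s) g t = (\<Sum>i\<in>I. c i * LS_integral (h i) g t)"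
  using assms(1,2)
proof (induction rule: finite_induct)
  case empty
  then show ?case by (simp add: LS_integral_def)
next
  case (insert i I)
  then show ?case
    using assms(3) by (simp add: LS_integral_add LS_integral_mult_left bounded_borel_intros bounded_borel_sum)
qed

section \<open>Cadlag paths\<close>

text \<open>The local form of the cadlag property that is needed for compactness arguments by bisection: close
to \<open>x\<close> the path is nearly constant on either side. At \<open>x = 0\<close> the second bound is void.\<close>

lemma cadlag_near:
  assumes "cadlag g" "0 \<le> x" "0 < e"
  obtains d where "0 < d"
    "\<And>s. x < s \<Longrightarrow> s < x + d \<Longrightarrow> \<bar>g s - g x\<bar> < e"
    "\<And>s. 0 \<le> s \<Longrightarrow> x - d < s \<Longrightarrow> s < x \<Longrightarrow> \<bar>g s - left_lim g x\<bar> < e"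
proof -
  have "(g \<longlongrightarrow> g x) (at_right x)" using assms by (auto simp: cadlag_def)
  then have "\<forall>\<^sub>F s in at_right x. \<bar>g s - g x\<bar> < e"
    using assms by (auto simp: tendsto_iff dist_real_def)
  then obtain b where b: "b > x" "\<And>s. x < s \<Longrightarrow> s < b \<Longrightarrow> \<bar>g s - g x\<bar> < e"
    by (auto simp: eventually_at_right[of x "x + 1"])
  have "\<exists>a<x. \<forall>s. 0 \<le> s \<longrightarrow> a < s \<longrightarrow> s < x \<longrightarrow> \<bar>g s - left_lim g x\<bar> < e"
  proof (cases "x = 0")
    case True
    then show ?thesis by (intro exI[of _ "-1"]) auto
  next
    case False
    then have "\<forall>\<^sub>F s in at_left x. \<bar>g s - left_lim g x\<bar> < e"
      using left_lim_tendsto[of g x] assms by (auto simp: tendsto_iff dist_real_def)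
    then show ?thesis by (auto simp: eventually_at_left[of "x - 1" x])
  qed
  then obtain a where a: "a < x" "\<And>s. 0 \<le> s \<Longrightarrow> a < s \<Longrightarrow> s < x \<Longrightarrow> \<bar>g s - left_lim g x\<bar> < e"
    by auto
  show ?thesis by (rule that[of "min (b - x) (x - a)"]) (use a b in auto)
qed

lemma left_lim_eq: "(g \<longlongrightarrow> l) (at_left s) \<Longrightarrow> left_lim g s = l"
  unfolding left_lim_def by (rule tendsto_Lim) simp_all

lemma left_lim_compose:
  assumes \<phi>: "continuous_on UNIV \<phi>" and y: "cadlag y" "0 < s"
  shows "left_lim (\<lambda>s. \<phi> (y s)) s = \<phi> (left_lim y s)"
proof (rule left_lim_eq)
  have "isCont \<phi> (left_lim y s)" using \<phi> by (simp add: continuous_on_eq_continuous_at)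
  then show "((\<lambda>s. \<phi> (y s)) \<longlongrightarrow> \<phi> (left_lim y s)) (at_left s)"
    by (rule isCont_tendsto_compose[OF _ left_lim_tendsto[OF y]])
qed

lemma cadlag_compose:
  assumes \<phi>: "continuous_on UNIV \<phi>" and y: "cadlag y"
  shows "cadlag (\<lambda>s. \<phi> (y s))"
proof -
  have "isCont \<phi> u" for u using \<phi> by (simp add: continuous_on_eq_continuous_at)
  from isCont_tendsto_compose[OF this] show ?thesis using y unfolding cadlag_def by blast
qed

lemma cadlag_diff: "cadlag x \<Longrightarrow> cadlag y \<Longrightarrow> cadlag (\<lambda>s. x s - y s)"
  unfolding cadlag_def by (blast intro: tendsto_diff)

lemma left_lim_diff:
  "cadlag x \<Longrightarrow> cadlag y \<Longrightarrow> 0 < s \<Longrightarrow> left_lim (\<lambda>s. x s - y s) s = left_lim x s - left_lim y s"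
  by (intro left_lim_eq tendsto_diff left_lim_tendsto)

lemma left_lim_dist_le:
  assumes "cadlag g" "0 < s" "a < s" "\<And>u. 0 \<le> u \<Longrightarrow> a < u \<Longrightarrow> u < s \<Longrightarrow> \<bar>g u - c\<bar> \<le> e"
  shows "\<bar>left_lim g s - c\<bar> \<le> e"
proof (rule tendsto_upperbound[where F = "at_left s" and f = "\<lambda>u. \<bar>g u - c\<bar>"])
  show "((\<lambda>u. \<bar>g u - c\<bar>) \<longlongrightarrow> \<bar>left_lim g s - c\<bar>) (at_left s)"
    by (intro tendsto_intros left_lim_tendsto assms)
  have "\<forall>\<^sub>F u in at_left s. max 0 a < u"
    by (rule order_tendstoD(1)[OF tendsto_ident_at]) (use assms in auto)
  moreover have "\<forall>\<^sub>F u in at_left s. u < s" by (simp add: eventually_at_filter)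
  ultimately show "\<forall>\<^sub>F u in at_left s. \<bar>g u - c\<bar> \<le> e"
    by eventually_elim (use assms(4) in auto)
qed simp

lemma cadlag_bounded:
  assumes "cadlag g"
  obtains C where "\<And>s. 0 \<le> s \<Longrightarrow> s \<le> t \<Longrightarrow> \<bar>g s\<bar> \<le> C"
    "\<And>s. 0 < s \<Longrightarrow> s \<le> t \<Longrightarrow> \<bar>left_lim g s\<bar> \<le> C"
proof -
  let ?P = "\<lambda>a b. 0 \<le> a \<longrightarrow> (\<exists>C. \<forall>s. a \<le> s \<and> s \<le> b \<longrightarrow> \<bar>g s\<bar> \<le> C)"
  have "0 \<le> max 0 t" by simp
  then have "?P 0 (max 0 t)"
  proof (induction rule: Bolzano[where P = ?P])
    case (trans a b c)
    show ?case
    proof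
      assume "0 \<le> a"
      then obtain C D where "\<And>s. a \<le> s \<Longrightarrow> s \<le> b \<Longrightarrow> \<bar>g s\<bar> \<le> C" "\<And>s. b \<le> s \<Longrightarrow> s \<le> c \<Longrightarrow> \<bar>g s\<bar> \<le> D"
        using trans by (meson order_trans)
      then have "\<bar>g s\<bar> \<le> max C D" if "a \<le> s" "s \<le> c" for s
        using that by (cases "s \<le> b") (auto simp: le_max_iff_disj)
      then show "\<exists>C. \<forall>s. a \<le> s \<and> s \<le> c \<longrightarrow> \<bar>g s\<bar> \<le> C" by blast
    qed
  next
    case (local x)
    obtain d where d: "0 < d" "\<And>s. x < s \<Longrightarrow> s < x + d \<Longrightarrow> \<bar>g s - g x\<bar> < 1"
      "\<And>s. 0 \<le> s \<Longrightarrow> x - d < s \<Longrightarrow> s < x \<Longrightarrow> \<bar>g s - left_lim g x\<bar> < 1"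
      by (rule cadlag_near[OF assms local(1) zero_less_one]) (rule that)
    show ?case
    proof (rule exI[of _ d], intro conjI allI impI d(1))
      fix a b assume ab: "a \<le> x \<and> x \<le> b \<and> b - a < d" and "0 \<le> a"
      have "\<bar>g s\<bar> \<le> \<bar>g x\<bar> + \<bar>left_lim g x\<bar> + 1" if "a \<le> s \<and> s \<le> b" for s
        using d(2)[of s] d(3)[of s] ab that \<open>0 \<le> a\<close> by (cases s x rule: linorder_cases) auto
      then show "\<exists>C. \<forall>s. a \<le> s \<and> s \<le> b \<longrightarrow> \<bar>g s\<bar> \<le> C" by blast
    qed
  qed
  then obtain C where "\<forall>s. 0 \<le> s \<and> s \<le> max 0 t \<longrightarrow> \<bar>g s\<bar> \<le> C" by auto
  then have C: "\<bar>g s\<bar> \<le> C" if "0 \<le> s" "s \<le> t" for s using that by auto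
  have "\<bar>left_lim g s\<bar> \<le> C" if "0 < s" "s \<le> t" for s
    using left_lim_dist_le[OF assms that(1) that(1), of 0 C] C that by auto
  then show ?thesis using C that by blast
qed

text \<open>Near any point \<open>x\<close> the path oscillates by less than \<open>\<delta> / 2\<close> on either side, so that only \<open>x\<close> itself
can carry a jump larger than \<open>\<delta>\<close>; finitely many such neighbourhoods cover \<open>[0, t]\<close>.\<close>

lemma finite_large_jumps:
  assumes "cadlag g" "0 < \<delta>"
  shows "finite {s \<in> {0<..t}. \<delta> < \<bar>jump g s\<bar>}"
proof -
  let ?P = "\<lambda>a b. finite {s \<in> {a..b}. 0 < s \<and> \<delta> < \<bar>jump g s\<bar>}"
  have "0 \<le> max 0 t" by simp
  then have "?P 0 (max 0 t)"
  proof (induction rule: Bolzano[where P = ?P])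
    case (trans a b c)
    have "{s \<in> {a..c}. 0 < s \<and> \<delta> < \<bar>jump g s\<bar>} \<subseteq>
        {s \<in> {a..b}. 0 < s \<and> \<delta> < \<bar>jump g s\<bar>} \<union> {s \<in> {b..c}. 0 < s \<and> \<delta> < \<bar>jump g s\<bar>}"
      by auto
    then show ?case using trans finite_subset by blast
  next
    case (local x)
    obtain d where d: "0 < d" "\<And>s. x < s \<Longrightarrow> s < x + d \<Longrightarrow> \<bar>g s - g x\<bar> < \<delta> / 2"
      "\<And>s. 0 \<le> s \<Longrightarrow> x - d < s \<Longrightarrow> s < x \<Longrightarrow> \<bar>g s - left_lim g x\<bar> < \<delta> / 2"
      by (rule cadlag_near[OF assms(1) local(1), of "\<delta> / 2"]) (use assms(2) that in auto)
    show ?case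
    proof (rule exI[of _ d], intro conjI allI impI d(1))
      fix a b assume ab: "a \<le> x \<and> x \<le> b \<and> b - a < d"
      have "\<bar>jump g s\<bar> \<le> \<delta>" if s: "a \<le> s" "s \<le> b" "0 < s" "s \<noteq> x" for s
      proof (cases "s < x")
        case True
        have "\<bar>left_lim g s - left_lim g x\<bar> \<le> \<delta> / 2"
          by (rule left_lim_dist_le[where a = "x - d"])
             (use d(3) s ab True assms in \<open>auto intro: less_imp_le\<close>)
        then show ?thesis using d(3)[of s] s ab True unfolding jump_def by linarith
      next
        case False
        have "\<bar>left_lim g s - g x\<bar> \<le> \<delta> / 2"
          by (rule left_lim_dist_le[where a = x])
             (use d(2) s ab False assms in \<open>auto intro: less_imp_le\<close>)
        then show ?thesis using d(2)[of s] s ab False unfolding jump_def by linarith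
      qed
      then have "{s \<in> {a..b}. 0 < s \<and> \<delta> < \<bar>jump g s\<bar>} \<subseteq> {x}" by force
      then show "finite {s \<in> {a..b}. 0 < s \<and> \<delta> < \<bar>jump g s\<bar>}" using finite_subset by blast
    qed
  qed
  then show ?thesis by (rule finite_subset[rotated]) auto
qed

section \<open>Riemann sums\<close>

text \<open>The partition of \<open>[0, t]\<close> into \<open>n + 1\<close> equal cells, and for \<open>s\<close> in \<open>(0, t]\<close> the end points of the cell
\<open>(left_node, right_node]\<close> that contains \<open>s\<close>. As \<open>n\<close> grows, the left end point tends to \<open>s\<close> strictly from
the left and the right end point tends to \<open>s\<close> from the right or equals \<open>s\<close>. For a cadlag path the
values at the end points therefore tend to the left limit and to the value at \<open>s\<close>.\<close>

definition node :: "real \<Rightarrow> nat \<Rightarrow> nat \<Rightarrow> real" where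
  "node t n i = t * real i / real (Suc n)"

definition right_node :: "real \<Rightarrow> nat \<Rightarrow> real \<Rightarrow> real" where
  "right_node t n s = t * of_int \<lceil>real (Suc n) * s / t\<rceil> / real (Suc n)"

definition left_node :: "real \<Rightarrow> nat \<Rightarrow> real \<Rightarrow> real" where
  "left_node t n s = right_node t n s - t / real (Suc n)"

lemma node_bounds:
  assumes "0 < t" "i \<le> Suc n"
  shows "0 \<le> node t n i" "node t n i \<le> t" "node t n i \<le> node t n (Suc i)"
proof -
  show "0 \<le> node t n i" "node t n i \<le> node t n (Suc i)"
    using assms by (auto simp: node_def intro!: divide_right_mono mult_left_mono)
  have "t * real i \<le> t * real (Suc n)" using assms by (intro mult_left_mono) auto
  then show "node t n i \<le> t" by (simp add: node_def field_simps)
qed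

lemma node_ends: "node t n 0 = 0" "node t n (Suc n) = t"
  by (simp_all add: node_def)

lemma node_cell:
  assumes "0 < t" "s \<in> {0<..t}"
  obtains k where "k < Suc n" "left_node t n s = node t n k" "right_node t n s = node t n (Suc k)"
    "\<And>i. s \<in> {node t n i<..node t n (Suc i)} \<longleftrightarrow> i = k"
proof -
  let ?c = "\<lceil>real (Suc n) * s / t\<rceil>"
  define k where "k = nat (?c - 1)"
  have "0 < real (Suc n) * s / t" using assms by auto
  then have "1 \<le> ?c" by linarith
  then have k: "of_int ?c = real (Suc k)" by (simp add: k_def)
  have "real (Suc n) * s \<le> real (Suc n) * t" using assms by (intro mult_left_mono) auto
  then have "real (Suc n) * s / t \<le> real (Suc n)" using assms by (simp add: field_simps)
  then have "?c \<le> int (Suc n)" by (simp add: ceiling_le_iff)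
  then have "k < Suc n" using k \<open>1 \<le> ?c\<close> by (simp add: k_def)
  have right: "right_node t n s = node t n (Suc k)" by (simp only: right_node_def node_def k)
  then have left: "left_node t n s = node t n k"
    by (simp add: left_node_def node_def field_simps)
  have "s \<in> {node t n i<..node t n (Suc i)} \<longleftrightarrow> i = k" for i
  proof -
    have "s \<in> {node t n i<..node t n (Suc i)} \<longleftrightarrow>
        of_int (int (Suc i)) - 1 < real (Suc n) * s / t \<and> real (Suc n) * s / t \<le> of_int (int (Suc i))"
      using assms by (simp add: node_def field_simps)
    also have "\<dots> \<longleftrightarrow> ?c = int (Suc i)" by (simp only: ceiling_eq_iff)
    also have "\<dots> \<longleftrightarrow> i = k" using \<open>1 \<le> ?c\<close> by (auto simp: k_def)
    finally show ?thesis .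
  qed
  with \<open>k < Suc n\<close> left right show ?thesis by (rule that)
qed

lemma node_around:
  assumes "0 < t" "s \<in> {0<..t}"
  shows "left_node t n s < s" "s \<le> right_node t n s" "0 \<le> left_node t n s" "left_node t n s \<le> t"
    "0 \<le> right_node t n s" "right_node t n s \<le> t"
proof -
  obtain k where k: "k < Suc n" "left_node t n s = node t n k" "right_node t n s = node t n (Suc k)"
    "\<And>i. s \<in> {node t n i<..node t n (Suc i)} \<longleftrightarrow> i = k"
    using node_cell[OF assms] by metis
  show "left_node t n s < s" "s \<le> right_node t n s" "0 \<le> left_node t n s" "left_node t n s \<le> t"
    "0 \<le> right_node t n s" "right_node t n s \<le> t"
    using k(4)[of k] k(1-3) node_bounds[OF assms(1), of k n] node_bounds[OF assms(1), of "Suc k" n]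
    by auto
qed

lemma node_tendsto:
  assumes "0 < t" "s \<in> {0<..t}"
  shows "(\<lambda>n. left_node t n s) \<longlonglongrightarrow> s" "(\<lambda>n. right_node t n s) \<longlonglongrightarrow> s"
proof -
  have "(\<lambda>n. t * inverse (real (Suc n))) \<longlonglongrightarrow> t * 0"
    by (rule tendsto_mult[OF tendsto_const LIMSEQ_inverse_real_of_nat])
  then have 0: "(\<lambda>n. t / real (Suc n)) \<longlonglongrightarrow> 0" by (simp add: divide_inverse)
  have lim: "(\<lambda>n. s - t / real (Suc n)) \<longlonglongrightarrow> s" using tendsto_diff[OF tendsto_const 0] by simp
  have low: "s - t / real (Suc n) \<le> left_node t n s" for n
    using node_around(2)[OF assms, of n] by (simp add: left_node_def)
  have up: "left_node t n s \<le> s" for n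
    using node_around(1)[OF assms, of n] by (rule less_imp_le)
  show *: "(\<lambda>n. left_node t n s) \<longlonglongrightarrow> s"
    by (rule tendsto_sandwich[OF always_eventually[OF allI] always_eventually[OF allI] lim tendsto_const])
       (rule low, rule up)
  have "(\<lambda>n. left_node t n s + t / real (Suc n)) \<longlonglongrightarrow> s + 0" by (rule tendsto_add[OF * 0])
  then show "(\<lambda>n. right_node t n s) \<longlonglongrightarrow> s" by (simp add: left_node_def)
qed

lemma cadlag_left_node_tendsto:
  assumes "cadlag w" "0 < t" "s \<in> {0<..t}"
  shows "(\<lambda>n. w (left_node t n s)) \<longlonglongrightarrow> left_lim w s"
proof -
  have "filterlim (\<lambda>n. left_node t n s) (at_left s) sequentially"
    unfolding filterlim_at using node_tendsto(1)[OF assms(2,3)] node_around(1)[OF assms(2,3)]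
    by (simp add: less_imp_neq)
  then show ?thesis
    using left_lim_tendsto[OF assms(1), of s] assms(3) by (auto intro: filterlim_compose)
qed

lemma cadlag_right_node_tendsto:
  assumes "cadlag w" "0 < t" "s \<in> {0<..t}"
  shows "(\<lambda>n. w (right_node t n s)) \<longlonglongrightarrow> w s"
proof -
  have "continuous (at s within {s..}) w"
    using assms by (simp add: continuous_within at_within_Ici_at_right cadlag_def)
  from continuous_within_tendsto_compose'[OF this _ node_tendsto(2)[OF assms(2,3)]] show ?thesis
    using node_around(2)[OF assms(2,3)] by simp
qed

lemma step_function_eq:
  assumes "0 < t" "s \<in> {0<..t}"
  shows "\<psi> (left_node t n s) (right_node t n s) =
    (\<Sum>i<Suc n. \<psi> (node t n i) (node t n (Suc i)) * indicator {node t n i<..node t n (Suc i)} s :: real)"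
proof -
  obtain k where k: "k < Suc n" "left_node t n s = node t n k" "right_node t n s = node t n (Suc k)"
    "\<And>i. s \<in> {node t n i<..node t n (Suc i)} \<longleftrightarrow> i = k"
    using node_cell[OF assms] by metis
  have "indicator {node t n i<..node t n (Suc i)} s = (if i = k then 1 else 0 :: real)" for i
    using k(4)[of i] by (simp add: indicator_def)
  then have "(\<Sum>i<Suc n. \<psi> (node t n i) (node t n (Suc i)) * indicator {node t n i<..node t n (Suc i)} s) =
      (\<Sum>i<Suc n. if i = k then \<psi> (node t n i) (node t n (Suc i)) else 0)"
    by (intro sum.cong) auto
  also have "\<dots> = \<psi> (node t n k) (node t n (Suc k))" using k(1) by (subst sum.delta) auto
  finally show ?thesis by (simp add: k)
qed

lemma bounded_borel_step_function:
  assumes "0 < t"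
  shows "bounded_borel t (\<lambda>s. \<psi> (left_node t n s) (right_node t n s))"
proof (subst bounded_borel_cong[OF step_function_eq[OF assms]])
  show "bounded_borel t (\<lambda>s. \<Sum>i<Suc n. \<psi> (node t n i) (node t n (Suc i)) *
      indicator {node t n i<..node t n (Suc i)} s)"
    by (intro bounded_borel_sum bounded_borel_mult bounded_borel_const bounded_borel_indicator) auto
qed

lemma bounded_borel_node_limit:
  assumes "0 < t" "\<And>a b. a \<in> {0..t} \<Longrightarrow> b \<in> {0..t} \<Longrightarrow> \<bar>\<psi> a b\<bar> \<le> C"
    and "\<And>s. s \<in> {0<..t} \<Longrightarrow> (\<lambda>n. \<psi> (left_node t n s) (right_node t n s)) \<longlonglongrightarrow> h s"
  shows "bounded_borel t h"
proof (rule bounded_borel_limit[where h = "\<lambda>n s. \<psi> (left_node t n s) (right_node t n s)"])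
  show "bounded_borel t (\<lambda>s. \<psi> (left_node t n s) (right_node t n s))" for n
    by (rule bounded_borel_step_function[OF assms(1)])
  show "\<bar>\<psi> (left_node t n s) (right_node t n s)\<bar> \<le> C" if "s \<in> {0<..t}" for n s
    using node_around[OF assms(1) that] by (intro assms(2)) auto
qed (rule assms(3))

lemma bounded_borel_cadlag:
  assumes "cadlag w"
  shows "bounded_borel t w" "bounded_borel t (left_lim w)"
proof -
  obtain C where C: "\<And>s. 0 \<le> s \<Longrightarrow> s \<le> t \<Longrightarrow> \<bar>w s\<bar> \<le> C" using cadlag_bounded[OF assms, of t] by metis
  have "bounded_borel t w \<and> bounded_borel t (left_lim w)"
  proof (cases "0 < t")
    case True
    have "bounded_borel t w"
      by (rule bounded_borel_node_limit[where \<psi> = "\<lambda>a b. w b"])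
         (use True C cadlag_right_node_tendsto[OF assms True] in auto)
    moreover have "bounded_borel t (left_lim w)"
      by (rule bounded_borel_node_limit[where \<psi> = "\<lambda>a b. w a"])
         (use True C cadlag_left_node_tendsto[OF assms True] in auto)
    ultimately show ?thesis ..
  next
    case False
    then have "{0<..t} = {}" by auto
    then show ?thesis by (simp add: bounded_borel_def)
  qed
  then show "bounded_borel t w" "bounded_borel t (left_lim w)" by simp_all
qed

text \<open>The Riemann sums are the integrals of the step functions
\<open>s \<mapsto> \<psi> (left_node t n s) (right_node t n s)\<close>, which converge to \<open>h\<close> pointwise and boundedly. Because
the weight \<open>\<psi>\<close> may depend on both ends of a cell, its limit may depend on both \<open>y\<^bsub>s-\<^esub>\<close> and \<open>y\<^sub>s\<close>; this is
what makes the chain rule below a statement about Riemann sums.\<close>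

proposition (in finite_variation_path) riemann_sums_tendsto:
  assumes t: "0 < t" and bound: "\<And>a b. a \<in> {0..t} \<Longrightarrow> b \<in> {0..t} \<Longrightarrow> \<bar>\<psi> a b\<bar> \<le> C"
    and lim: "\<And>s. s \<in> {0<..t} \<Longrightarrow> (\<lambda>n. \<psi> (left_node t n s) (right_node t n s)) \<longlonglongrightarrow> h s"
  shows "(\<lambda>n. \<Sum>i<Suc n. \<psi> (node t n i) (node t n (Suc i)) * (g (node t n (Suc i)) - g (node t n i)))
    \<longlonglongrightarrow> LS_integral h g t"
proof -
  have "LS_integral (\<lambda>s. \<psi> (left_node t n s) (right_node t n s)) g t =
      (\<Sum>i<Suc n. \<psi> (node t n i) (node t n (Suc i)) * (g (node t n (Suc i)) - g (node t n i)))" for n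
  proof -
    have "LS_integral (\<lambda>s. \<psi> (left_node t n s) (right_node t n s)) g t =
        LS_integral (\<lambda>s. \<Sum>i<Suc n. \<psi> (node t n i) (node t n (Suc i)) *
          indicator {node t n i<..node t n (Suc i)} s) g t"
      by (rule LS_integral_cong[OF step_function_eq[OF t]])
    also have "\<dots> = (\<Sum>i<Suc n. \<psi> (node t n i) (node t n (Suc i)) *
          LS_integral (indicator {node t n i<..node t n (Suc i)}) g t)"
      using t by (intro LS_integral_sum) (auto intro: bounded_borel_indicator)
    also have "\<dots> = (\<Sum>i<Suc n. \<psi> (node t n i) (node t n (Suc i)) * (g (node t n (Suc i)) - g (node t n i)))"
      using node_bounds[OF t] by (intro sum.cong refl arg_cong2[where f = "(*)"] LS_integral_Ioc) auto
    finally show ?thesis .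
  qed
  moreover have "(\<lambda>n. LS_integral (\<lambda>s. \<psi> (left_node t n s) (right_node t n s)) g t) \<longlonglongrightarrow> LS_integral h g t"
  proof (rule LS_integral_dominated_convergence[where C = C])
    show "bounded_borel t (\<lambda>s. \<psi> (left_node t n s) (right_node t n s))" for n
      by (rule bounded_borel_step_function[OF t])
    show "\<bar>\<psi> (left_node t n s) (right_node t n s)\<bar> \<le> C" if "s \<in> {0<..t}" for n s
      using node_around[OF t that] by (intro bound) auto
  qed (use t lim in auto)
  ultimately show ?thesis by simp
qed

lemma (in finite_variation_path) riemann_sums_right:
  assumes "0 < t" "cadlag h"
  shows "(\<lambda>n. \<Sum>i<Suc n. h (node t n (Suc i)) * (g (node t n (Suc i)) - g (node t n i)))
    \<longlonglongrightarrow> LS_integral h g t"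
proof -
  obtain C where "\<And>s. 0 \<le> s \<Longrightarrow> s \<le> t \<Longrightarrow> \<bar>h s\<bar> \<le> C" using cadlag_bounded[OF assms(2), of t] by metis
  then show ?thesis
    by (intro riemann_sums_tendsto[where \<psi> = "\<lambda>a b. h b"]) 
       (use assms cadlag_right_node_tendsto in auto)
qed

lemma (in finite_variation_path) riemann_sums_left:
  assumes "0 < t" "cadlag h"
  shows "(\<lambda>n. \<Sum>i<Suc n. h (node t n i) * (g (node t n (Suc i)) - g (node t n i)))
    \<longlonglongrightarrow> LS_integral (left_lim h) g t"
proof -
  obtain C where "\<And>s. 0 \<le> s \<Longrightarrow> s \<le> t \<Longrightarrow> \<bar>h s\<bar> \<le> C" using cadlag_bounded[OF assms(2), of t] by metis
  then show ?thesis
    by (intro riemann_sums_tendsto[where \<psi> = "\<lambda>a b. h a"]) 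
       (use assms cadlag_left_node_tendsto in auto)
qed

text \<open>On every partition this is summation by parts. Taking the integrand \<open>h\<close> at right end points and \<open>g\<close> at
left end points makes the identity exact, with no sum over common jumps.\<close>

proposition integration_by_parts:
  assumes g: "finite_variation_path g" and h: "finite_variation_path h" and t: "0 < t"
  shows "LS_integral h g t + LS_integral (left_lim g) h t = h t * g t - h 0 * g 0"
proof -
  interpret g: finite_variation_path g by fact
  interpret h: finite_variation_path h by fact
  let ?R = "\<lambda>n. \<Sum>i<Suc n. h (node t n (Suc i)) * (g (node t n (Suc i)) - g (node t n i))"
  let ?L = "\<lambda>n. \<Sum>i<Suc n. g (node t n i) * (h (node t n (Suc i)) - h (node t n i))"
  have "(\<lambda>n. ?R n + ?L n) \<longlonglongrightarrow> LS_integral h g t + LS_integral (left_lim g) h t"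
    by (intro tendsto_add g.riemann_sums_right h.riemann_sums_left t g.cadlag h.cadlag)
  moreover have "?R n + ?L n = h t * g t - h 0 * g 0" for n
  proof -
    have "?R n + ?L n = (\<Sum>i<Suc n. h (node t n (Suc i)) * g (node t n (Suc i)) - h (node t n i) * g (node t n i))"
      unfolding sum.distrib[symmetric] by (intro sum.cong) (auto simp: algebra_simps)
    also have "\<dots> = h (node t n (Suc n)) * g (node t n (Suc n)) - h (node t n 0) * g (node t n 0)"
      by (rule sum_lessThan_telescope)
    finally show ?thesis by (simp add: node_ends)
  qed
  ultimately show ?thesis by (simp add: LIMSEQ_const_iff)
qed

section \<open>Chain rule\<close>

text \<open>The difference quotient of \<open>\<phi>\<close>, extended continuously to the diagonal by the derivative.\<close>

definition diff_quotient :: "(real \<Rightarrow> real) \<Rightarrow> (real \<Rightarrow> real) \<Rightarrow> real \<Rightarrow> real \<Rightarrow> real" where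
  "diff_quotient \<phi> \<phi>' a b = (if a = b then \<phi>' a else (\<phi> b - \<phi> a) / (b - a))"

lemma diff_quotient_mult: "diff_quotient \<phi> \<phi>' a b * (b - a) = \<phi> b - \<phi> a"
  by (simp add: diff_quotient_def)

locale C1_function =
  fixes \<phi> \<phi>' :: "real \<Rightarrow> real"
  assumes deriv: "\<And>u. (\<phi> has_real_derivative \<phi>' u) (at u)" and cont: "continuous_on UNIV \<phi>'"
begin

lemma diff_quotient_mean_value:
  obtains \<xi> where "min a b \<le> \<xi>" "\<xi> \<le> max a b" "diff_quotient \<phi> \<phi>' a b = \<phi>' \<xi>"
proof (cases a b rule: linorder_cases)
  case equal
  then show ?thesis using that[of a] by (simp add: diff_quotient_def)
next
  case less
  then obtain z where "z > a" "z < b" "\<phi> b - \<phi> a = (b - a) * \<phi>' z" using MVT2 deriv by blast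
  then show ?thesis using less that[of z] by (simp add: diff_quotient_def)
next
  case greater
  then obtain z where "z > b" "z < a" "\<phi> a - \<phi> b = (a - b) * \<phi>' z" using MVT2 deriv by blast
  then show ?thesis using greater that[of z] by (simp add: diff_quotient_def field_simps)
qed

lemma deriv_bounded: obtains C where "C \<ge> 0" "\<And>u. \<bar>u\<bar> \<le> r \<Longrightarrow> \<bar>\<phi>' u\<bar> \<le> C"
proof -
  have "bounded (\<phi>' ` {-r..r})"
    using cont by (intro compact_imp_bounded compact_continuous_image) (auto intro: continuous_on_subset)
  then obtain C where C: "\<forall>u\<in>{-r..r}. \<bar>\<phi>' u\<bar> \<le> C" by (auto simp: bounded_real)
  show ?thesis
  proof (rule that[of "max C 0"])
    show "\<bar>\<phi>' u\<bar> \<le> max C 0" if "\<bar>u\<bar> \<le> r" for u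
      using C[rule_format, of u] that by (simp add: abs_le_iff le_max_iff_disj)
  qed simp
qed

lemma diff_quotient_bounded:
  obtains C where "C \<ge> 0" "\<And>a b. \<bar>a\<bar> \<le> r \<Longrightarrow> \<bar>b\<bar> \<le> r \<Longrightarrow> \<bar>diff_quotient \<phi> \<phi>' a b\<bar> \<le> C"
proof -
  obtain C where C: "C \<ge> 0" "\<And>u. \<bar>u\<bar> \<le> r \<Longrightarrow> \<bar>\<phi>' u\<bar> \<le> C" by (rule deriv_bounded) (rule that)
  have "\<bar>diff_quotient \<phi> \<phi>' a b\<bar> \<le> C" if "\<bar>a\<bar> \<le> r" "\<bar>b\<bar> \<le> r" for a b
  proof -
    obtain \<xi> where "min a b \<le> \<xi>" "\<xi> \<le> max a b" "diff_quotient \<phi> \<phi>' a b = \<phi>' \<xi>"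
      by (rule diff_quotient_mean_value) (rule that)
    then show ?thesis using C(2)[of \<xi>] that by auto
  qed
  with C(1) show ?thesis by (rule that)
qed

text \<open>Joint continuity of the difference quotient. Off the diagonal it is a quotient of continuous
functions; at the diagonal, by the mean value theorem, it is a value of \<open>\<phi>'\<close> at an intermediate
point.\<close>

lemma diff_quotient_tendsto:
  assumes a: "(a \<longlongrightarrow> \<alpha>) G" and b: "(b \<longlongrightarrow> \<beta>) G"
  shows "((\<lambda>n. diff_quotient \<phi> \<phi>' (a n) (b n)) \<longlongrightarrow> diff_quotient \<phi> \<phi>' \<alpha> \<beta>) G"
proof (cases "\<alpha> = \<beta>")
  case False
  note compose = isCont_tendsto_compose[OF DERIV_isCont[OF deriv]]
  have "((\<lambda>n. (\<phi> (b n) - \<phi> (a n)) / (b n - a n)) \<longlongrightarrow> (\<phi> \<beta> - \<phi> \<alpha>) / (\<beta> - \<alpha>)) G"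
    by (rule tendsto_divide[OF tendsto_diff[OF compose[OF b] compose[OF a]] tendsto_diff[OF b a]])
       (use False in simp)
  moreover have "\<forall>\<^sub>F n in G. b n - a n \<noteq> 0"
    by (rule tendsto_imp_eventually_ne[OF tendsto_diff[OF b a]]) (use False in simp)
  then have "\<forall>\<^sub>F n in G. (\<phi> (b n) - \<phi> (a n)) / (b n - a n) = diff_quotient \<phi> \<phi>' (a n) (b n)"
    by eventually_elim (simp add: diff_quotient_def)
  ultimately have "((\<lambda>n. diff_quotient \<phi> \<phi>' (a n) (b n)) \<longlongrightarrow> (\<phi> \<beta> - \<phi> \<alpha>) / (\<beta> - \<alpha>)) G"
    by (rule Lim_transform_eventually)
  then show ?thesis using False by (simp add: diff_quotient_def[of _ _ \<alpha>])
next
  case True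
  have "\<forall>n. \<exists>z. min (a n) (b n) \<le> z \<and> z \<le> max (a n) (b n) \<and> diff_quotient \<phi> \<phi>' (a n) (b n) = \<phi>' z"
    by (metis diff_quotient_mean_value)
  then obtain \<xi> where "\<forall>n. min (a n) (b n) \<le> \<xi> n \<and> \<xi> n \<le> max (a n) (b n) \<and>
      diff_quotient \<phi> \<phi>' (a n) (b n) = \<phi>' (\<xi> n)"
    using choice by metis
  then have \<xi>: "min (a n) (b n) \<le> \<xi> n" "\<xi> n \<le> max (a n) (b n)"
    "diff_quotient \<phi> \<phi>' (a n) (b n) = \<phi>' (\<xi> n)" for n by blast+
  have lim: "((\<lambda>n. min (a n) (b n)) \<longlongrightarrow> \<alpha>) G" "((\<lambda>n. max (a n) (b n)) \<longlongrightarrow> \<alpha>) G"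
    using tendsto_min[OF a b] tendsto_max[OF a b] True by simp_all
  have "(\<xi> \<longlongrightarrow> \<alpha>) G"
    by (rule tendsto_sandwich[OF always_eventually[OF allI] always_eventually[OF allI] lim])
       (rule \<xi>(1), rule \<xi>(2))
  moreover have "isCont \<phi>' \<alpha>" using cont by (simp add: continuous_on_eq_continuous_at)
  ultimately have "((\<lambda>n. \<phi>' (\<xi> n)) \<longlongrightarrow> \<phi>' \<alpha>) G" by (rule isCont_tendsto_compose[rotated])
  then show ?thesis using True by (simp add: \<xi> diff_quotient_def[of _ _ \<beta>])
qed

lemma continuous: "continuous_on UNIV \<phi>"
  using deriv by (meson DERIV_isCont continuous_at_imp_continuous_on)

lemma finite_variation_path_compose:
  assumes "finite_variation_path y"
  shows "finite_variation_path (\<lambda>s. \<phi> (y s))"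
proof
  interpret finite_variation_path y by fact
  show "cadlag (\<lambda>s. \<phi> (y s))" by (rule cadlag_compose[OF continuous cadlag])
  show "finite_variation (\<lambda>s. \<phi> (y s))"
    unfolding finite_variation_def
  proof (intro allI impI)
    fix t :: real assume t: "0 \<le> t"
    obtain r where r: "\<And>s. 0 \<le> s \<Longrightarrow> s \<le> t \<Longrightarrow> \<bar>y s\<bar> \<le> r" using cadlag_bounded[OF cadlag, of t] by metis
    obtain C where C: "C \<ge> 0" "\<And>a b. \<bar>a\<bar> \<le> r \<Longrightarrow> \<bar>b\<bar> \<le> r \<Longrightarrow> \<bar>diff_quotient \<phi> \<phi>' a b\<bar> \<le> C"
      by (rule diff_quotient_bounded) (rule that)
    have lip: "\<bar>\<phi> b - \<phi> a\<bar> \<le> C * \<bar>b - a\<bar>" if "\<bar>a\<bar> \<le> r" "\<bar>b\<bar> \<le> r" for a b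
      using mult_right_mono[OF C(2)[OF that] abs_ge_zero[of "b - a"]]
      by (simp add: abs_mult[symmetric] diff_quotient_mult)
    show "bdd_above (variation_sums (\<lambda>s. \<phi> (y s)) t)"
    proof (rule bdd_aboveI)
      fix S assume "S \<in> variation_sums (\<lambda>s. \<phi> (y s)) t"
      then obtain p :: "nat \<Rightarrow> real" and n where p: "mono_on {..n} p" "p ` {..n} \<subseteq> {0..t}"
        and S: "S = (\<Sum>i<n. \<bar>\<phi> (y (p (Suc i))) - \<phi> (y (p i))\<bar>)"
        by (auto simp: variation_sums_def)
      have "S \<le> (\<Sum>i<n. C * \<bar>y (p (Suc i)) - y (p i)\<bar>)"
        unfolding S by (intro sum_mono lip r) (use p(2) in \<open>auto simp: image_subset_iff\<close>)
      also have "\<dots> \<le> C * total_variation y t"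
        unfolding sum_distrib_left[symmetric]
        by (intro mult_left_mono C variation_sum_le_total_variation finite_variation t p)
      finally show "S \<le> C * total_variation y t" .
    qed
  qed
qed

lemma diff_quotient_path:
  assumes y: "cadlag y" and t: "0 < t"
  obtains C where "\<And>a b. a \<in> {0..t} \<Longrightarrow> b \<in> {0..t} \<Longrightarrow> \<bar>diff_quotient \<phi> \<phi>' (y a) (y b)\<bar> \<le> C"
    "\<And>s. s \<in> {0<..t} \<Longrightarrow> (\<lambda>n. diff_quotient \<phi> \<phi>' (y (left_node t n s)) (y (right_node t n s)))
      \<longlonglongrightarrow> diff_quotient \<phi> \<phi>' (left_lim y s) (y s)"
proof -
  obtain r where r: "\<And>s. 0 \<le> s \<Longrightarrow> s \<le> t \<Longrightarrow> \<bar>y s\<bar> \<le> r" using cadlag_bounded[OF y, of t] by metis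
  obtain C where C: "C \<ge> 0" "\<And>a b. \<bar>a\<bar> \<le> r \<Longrightarrow> \<bar>b\<bar> \<le> r \<Longrightarrow> \<bar>diff_quotient \<phi> \<phi>' a b\<bar> \<le> C"
    by (rule diff_quotient_bounded) (rule that)
  show ?thesis
    by (rule that[of C]) (use r C t in \<open>auto intro!: diff_quotient_tendsto
      cadlag_left_node_tendsto cadlag_right_node_tendsto y\<close>)
qed

lemma bounded_borel_diff_quotient:
  assumes "cadlag y" "0 < t"
  shows "bounded_borel t (\<lambda>s. diff_quotient \<phi> \<phi>' (left_lim y s) (y s))"
proof -
  obtain C where C: "\<And>a b. a \<in> {0..t} \<Longrightarrow> b \<in> {0..t} \<Longrightarrow> \<bar>diff_quotient \<phi> \<phi>' (y a) (y b)\<bar> \<le> C"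
    "\<And>s. s \<in> {0<..t} \<Longrightarrow> (\<lambda>n. diff_quotient \<phi> \<phi>' (y (left_node t n s)) (y (right_node t n s)))
      \<longlonglongrightarrow> diff_quotient \<phi> \<phi>' (left_lim y s) (y s)"
    by (rule diff_quotient_path[OF assms]) (rule that)
  show ?thesis by (rule bounded_borel_node_limit[OF assms(2) C])
qed

text \<open>The increment of \<open>\<phi> \<circ> y\<close> over a cell is exactly the difference quotient of \<open>\<phi>\<close> at the two values of
\<open>y\<close> times the increment of \<open>y\<close>. So the Riemann sums of both sides coincide, and the difference
quotient at \<open>(y\<^bsub>s-\<^esub>, y\<^sub>s)\<close> accounts for the continuous part (where it is \<open>\<phi>' (y\<^sub>s)\<close>) and for the jumps
at once.\<close>

proposition chain_rule:
  assumes y: "finite_variation_path y" and h: "cadlag h" and t: "0 < t"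
  shows "LS_integral h (\<lambda>s. \<phi> (y s)) t =
    LS_integral (\<lambda>s. h s * diff_quotient \<phi> \<phi>' (left_lim y s) (y s)) y t"
proof -
  interpret y: finite_variation_path y by fact
  interpret \<phi>y: finite_variation_path "\<lambda>s. \<phi> (y s)" by (rule finite_variation_path_compose[OF y])
  let ?q = "diff_quotient \<phi> \<phi>'"
  obtain C where C: "\<And>a b. a \<in> {0..t} \<Longrightarrow> b \<in> {0..t} \<Longrightarrow> \<bar>?q (y a) (y b)\<bar> \<le> C"
    "\<And>s. s \<in> {0<..t} \<Longrightarrow> (\<lambda>n. ?q (y (left_node t n s)) (y (right_node t n s))) \<longlonglongrightarrow> ?q (left_lim y s) (y s)"
    by (rule diff_quotient_path[OF y.cadlag t]) (rule that)
  obtain D where D: "\<And>s. 0 \<le> s \<Longrightarrow> s \<le> t \<Longrightarrow> \<bar>h s\<bar> \<le> D" using cadlag_bounded[OF h, of t] by metis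
  have "0 \<le> D" using D[of 0] t by auto
  have "(\<lambda>n. \<Sum>i<Suc n. (h (node t n (Suc i)) * ?q (y (node t n i)) (y (node t n (Suc i)))) *
      (y (node t n (Suc i)) - y (node t n i)))
    \<longlonglongrightarrow> LS_integral (\<lambda>s. h s * ?q (left_lim y s) (y s)) y t"
  proof (rule y.riemann_sums_tendsto[OF t, where \<psi> = "\<lambda>a b. h b * ?q (y a) (y b)" and C = "D * C"])
    show "\<bar>h b * ?q (y a) (y b)\<bar> \<le> D * C" if "a \<in> {0..t}" "b \<in> {0..t}" for a b
      unfolding abs_mult by (rule mult_mono) (use C(1) D that \<open>0 \<le> D\<close> in auto)
  qed (intro tendsto_mult C(2) cadlag_right_node_tendsto h t)
  then have "(\<lambda>n. \<Sum>i<Suc n. h (node t n (Suc i)) * (\<phi> (y (node t n (Suc i))) - \<phi> (y (node t n i))))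
      \<longlonglongrightarrow> LS_integral (\<lambda>s. h s * ?q (left_lim y s) (y s)) y t"
    by (simp only: mult.assoc diff_quotient_mult)
  then show ?thesis
    using \<phi>y.riemann_sums_right[OF t h] by (rule LIMSEQ_unique[rotated])
qed

end

lemma (in finite_variation_path) LS_integral_1:
  assumes "0 \<le> t"
  shows "LS_integral (\<lambda>_. 1) g t = g t - g 0"
  using LS_integral_Ioc[of 0 t t] LS_integral_cong[of t "indicator {0<..t}" "\<lambda>_. 1" g] assms by auto

lemma (in C1_function) fundamental_theorem:
  assumes y: "finite_variation_path y" and t: "0 < t"
  shows "\<phi> (y t) - \<phi> (y 0) = LS_integral (\<lambda>s. diff_quotient \<phi> \<phi>' (left_lim y s) (y s)) y t"
proof -
  have "cadlag (\<lambda>_. 1)" by (auto simp: cadlag_def)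
  then show ?thesis
    using chain_rule[OF y _ t, of "\<lambda>_. 1"]
      finite_variation_path.LS_integral_1[OF finite_variation_path_compose[OF y], of t] t by simp
qed

section \<open>Integrands supported by jumps\<close>

lemma (in finite_variation_path) LS_integral_finite_set:
  assumes "finite A" "A \<subseteq> {0<..t}" "0 \<le> t"
  shows "LS_integral (\<lambda>s. k s * indicator A s) g t = (\<Sum>s\<in>A. k s * jump g s)"
proof -
  have "LS_integral (\<lambda>s. k s * indicator A s) g t = LS_integral (\<lambda>s. \<Sum>u\<in>A. k u * indicator {u} s) g t"
  proof (rule LS_integral_cong)
    fix s
    have "(\<Sum>u\<in>A. k u * indicator {u} s) = (\<Sum>u\<in>A. if u = s then k u else 0)"
      by (intro sum.cong) (auto simp: indicator_def)
    also have "\<dots> = k s * indicator A s" using assms(1) by (subst sum.delta) (auto simp: indicator_def)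
    finally show "k s * indicator A s = (\<Sum>u\<in>A. k u * indicator {u} s)" ..
  qed
  also have "\<dots> = (\<Sum>u\<in>A. k u * LS_integral (indicator {u}) g t)"
    using assms by (intro LS_integral_sum) (auto intro: bounded_borel_indicator)
  also have "\<dots> = (\<Sum>u\<in>A. k u * jump g u)"
    using assms by (intro sum.cong refl arg_cong2[where f = "(*)"] LS_integral_singleton) auto
  finally show ?thesis .
qed

text \<open>An integrand dominated by the jumps of a cadlag path exceeds \<open>C * \<delta>\<close> only at finitely many points.
Once a finite set \<open>B\<close> contains these, the sum over \<open>B\<close> is the integral of \<open>k\<close> restricted to \<open>B\<close>, and
the rest of the integral is at most \<open>C * \<delta>\<close> times the total variation.\<close>

proposition (in finite_variation_path) has_sum_jumps:
  assumes k: "bounded_borel t k" and w: "cadlag w" and C: "0 \<le> C"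
    and le: "\<And>s. s \<in> {0<..t} \<Longrightarrow> \<bar>k s\<bar> \<le> C * \<bar>jump w s\<bar>" and t: "0 \<le> t"
  shows "((\<lambda>s. k s * jump g s) has_sum LS_integral k g t) {0<..t}"
  unfolding has_sum_def
proof (rule tendstoI)
  fix e :: real assume "0 < e"
  let ?V = "total_variation g t"
  have V: "0 \<le> ?V" using tv_integral_const[OF t, of 1] tv_integral_mono[of t "\<lambda>_. 0" "\<lambda>_. 1"] t
      tv_integral_const[OF t, of 0] by simp
  define \<delta> where "\<delta> = e / ((C + 1) * (?V + 1))"
  have \<delta>: "0 < \<delta>" using \<open>0 < e\<close> C V by (simp add: \<delta>_def)
  let ?A = "{s \<in> {0<..t}. \<delta> < \<bar>jump w s\<bar>}"
  have "\<forall>\<^sub>F B in finite_subsets_at_top {0<..t}. finite B \<and> ?A \<subseteq> B \<and> B \<subseteq> {0<..t}"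
    unfolding eventually_finite_subsets_at_top
    by (intro exI[of _ ?A]) (use finite_large_jumps[OF w \<delta>] in auto)
  then show "\<forall>\<^sub>F B in finite_subsets_at_top {0<..t}. dist (\<Sum>s\<in>B. k s * jump g s) (LS_integral k g t) < e"
  proof eventually_elim
    case (elim B)
    have kB: "bounded_borel t (\<lambda>s. k s * indicator B s)"
      using elim by (intro bounded_borel_mult k bounded_borel_indicator) (auto intro: borel_closed finite_imp_closed)
    have "\<bar>LS_integral k g t - (\<Sum>s\<in>B. k s * jump g s)\<bar> = \<bar>LS_integral (\<lambda>s. k s - k s * indicator B s) g t\<bar>"
      using elim LS_integral_diff[OF k kB t] LS_integral_finite_set[of B t k] t by simp
    also have "\<dots> \<le> tv_integral (\<lambda>s. \<bar>k s - k s * indicator B s\<bar>) g t"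
      by (intro abs_LS_integral_le bounded_borel_diff k kB t)
    also have "\<dots> \<le> tv_integral (\<lambda>_. C * \<delta>) g t"
    proof (rule tv_integral_mono)
      fix s assume s: "s \<in> {0<..t}"
      show "\<bar>k s - k s * indicator B s\<bar> \<le> C * \<delta>"
      proof (cases "s \<in> B")
        case False
        then have "\<bar>jump w s\<bar> \<le> \<delta>" using elim s by force
        then have "C * \<bar>jump w s\<bar> \<le> C * \<delta>" using C by (intro mult_left_mono)
        then show ?thesis using le[OF s] False by simp
      qed (use C \<delta> in simp)
    qed (intro bounded_borel_intros k kB t)+
    also have "\<dots> = C * ?V * \<delta>" by (simp add: tv_integral_const[OF t])
    also have "\<dots> < (C + 1) * (?V + 1) * \<delta>"
      using C V \<delta> by (intro mult_strict_right_mono) (auto simp: algebra_simps add_nonneg_pos)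
    also have "\<dots> = e" using C V by (simp add: \<delta>_def)
    finally show ?case by (simp add: dist_real_def abs_minus_commute)
  qed
qed

section \<open>Integral processes\<close>

lemma LS_integral_restrict:
  assumes "u \<le> t"
  shows "LS_integral (\<lambda>s. v s * indicator {0<..u} s) g t = LS_integral v g u"
proof -
  have "(\<lambda>s. indicator {0<..t} s *\<^sub>R (v s * indicator {0<..u} s)) = (\<lambda>s. indicator {0<..u} s *\<^sub>R v s)"
    using assms by (intro ext) (simp add: indicator_def)
  then show ?thesis by (simp only: LS_integral_def set_lebesgue_integral_def)
qed

lemma tv_integral_restrict:
  assumes "u \<le> t"
  shows "tv_integral (\<lambda>s. v s * indicator {0<..u} s) g t = tv_integral v g u"
proof -
  have "(\<lambda>s. indicator {0<..t} s *\<^sub>R (v s * indicator {0<..u} s)) = (\<lambda>s. indicator {0<..u} s *\<^sub>R v s)"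
    using assms by (intro ext) (simp add: indicator_def)
  then show ?thesis by (simp only: tv_integral_def set_lebesgue_integral_def)
qed

lemma indicator_Ioc_diff:
  fixes l r s :: real
  assumes "0 \<le> l" "l \<le> r"
  shows "indicator {0<..r} s = indicator {0<..l} s + (indicator {l<..r} s :: real)"
  using assms by (auto simp: indicator_def)

context finite_variation_path
begin

lemma LS_integral_over_Ioc:
  assumes v: "bounded_borel t v" and lr: "0 \<le> l" "l \<le> r" "r \<le> t"
  shows "LS_integral (\<lambda>s. v s * indicator {l<..r} s) g t = LS_integral v g r - LS_integral v g l"
proof -
  have "LS_integral v g r = LS_integral (\<lambda>s. v s * indicator {0<..l} s + v s * indicator {l<..r} s) g t"
    unfolding LS_integral_restrict[OF lr(3), symmetric] indicator_Ioc_diff[OF lr(1,2)]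
    by (simp add: distrib_left)
  also have "\<dots> = LS_integral (\<lambda>s. v s * indicator {0<..l} s) g t + LS_integral (\<lambda>s. v s * indicator {l<..r} s) g t"
    using lr by (intro LS_integral_add bounded_borel_mult v bounded_borel_indicator) auto
  finally show ?thesis using lr by (simp add: LS_integral_restrict)
qed

lemma tv_integral_over_Ioc:
  assumes v: "bounded_borel t v" and lr: "0 \<le> l" "l \<le> r" "r \<le> t"
  shows "tv_integral (\<lambda>s. v s * indicator {l<..r} s) g t = tv_integral v g r - tv_integral v g l"
proof -
  have "tv_integral v g r = tv_integral (\<lambda>s. v s * indicator {0<..l} s + v s * indicator {l<..r} s) g t"
    unfolding tv_integral_restrict[OF lr(3), symmetric] indicator_Ioc_diff[OF lr(1,2)]
    by (simp add: distrib_left)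
  also have "\<dots> = tv_integral (\<lambda>s. v s * indicator {0<..l} s) g t + tv_integral (\<lambda>s. v s * indicator {l<..r} s) g t"
    using lr by (intro tv_integral_add bounded_borel_mult v bounded_borel_indicator) auto
  finally show ?thesis using lr by (simp add: tv_integral_restrict)
qed

lemma LS_integral_increment_le:
  assumes v: "bounded_borel t v" and lr: "0 \<le> l" "l \<le> r" "r \<le> t"
  shows "\<bar>LS_integral v g r - LS_integral v g l\<bar> \<le> tv_integral (\<lambda>s. \<bar>v s\<bar>) g r - tv_integral (\<lambda>s. \<bar>v s\<bar>) g l"
proof -
  have "\<bar>LS_integral v g r - LS_integral v g l\<bar> \<le> tv_integral (\<lambda>s. \<bar>v s * indicator {l<..r} s\<bar>) g t"
    unfolding LS_integral_over_Ioc[OF assms, symmetric]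
    using lr by (intro abs_LS_integral_le bounded_borel_mult v bounded_borel_indicator) auto
  also have "\<dots> = tv_integral (\<lambda>s. \<bar>v s\<bar> * indicator {l<..r} s) g t"
    by (simp add: abs_mult)
  also have "\<dots> = tv_integral (\<lambda>s. \<bar>v s\<bar>) g r - tv_integral (\<lambda>s. \<bar>v s\<bar>) g l"
    by (rule tv_integral_over_Ioc[OF bounded_borel_abs[OF v] lr])
  finally show ?thesis .
qed

lemma tv_integral_increment_le:
  assumes v: "bounded_borel t v" and lr: "0 \<le> l" "l \<le> r" "r \<le> t"
    and c: "\<And>s. s \<in> {0<..t} \<Longrightarrow> v s \<le> c"
  shows "tv_integral v g r - tv_integral v g l \<le> c * (total_variation g r - total_variation g l)"
proof -
  have "tv_integral (\<lambda>s. v s * indicator {l<..r} s) g t \<le> tv_integral (\<lambda>s. c * indicator {l<..r} s) g t"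
    using lr c by (intro tv_integral_mono bounded_borel_mult v bounded_borel_indicator bounded_borel_const)
      (auto simp: indicator_def)
  then show ?thesis
    using lr by (simp add: tv_integral_over_Ioc[OF v lr] tv_integral_over_Ioc[OF bounded_borel_const lr]
        tv_integral_const algebra_simps)
qed

lemma LS_integral_right_continuous:
  assumes v: "bounded_borel t v" and u: "0 \<le> u" "u < t"
  shows "((\<lambda>r. LS_integral v g r) \<longlongrightarrow> LS_integral v g u) (at_right u)"
proof -
  obtain c where c: "c \<ge> 0" "\<And>s. s \<in> {0<..t} \<Longrightarrow> \<bar>v s\<bar> \<le> c"
    using v by (rule bounded_borelE) (rule that)
  let ?V = "total_variation g"
  have "\<forall>\<^sub>F r in at_right u. r < t" by (rule order_tendstoD(2)[OF tendsto_ident_at u(2)])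
  then have le: "\<forall>\<^sub>F r in at_right u. norm (LS_integral v g r - LS_integral v g u) \<le> norm (c * (?V r - ?V u))"
    using eventually_at_right_less[of u]
  proof eventually_elim
    case (elim r)
    then have "\<bar>LS_integral v g r - LS_integral v g u\<bar> \<le> c * (?V r - ?V u)"
      using LS_integral_increment_le[OF v, of u r] c(2) u
        tv_integral_increment_le[OF bounded_borel_abs[OF v], of u r c] by force
    then show ?case by simp
  qed
  have "((\<lambda>r. c * (?V r - ?V u)) \<longlongrightarrow> c * (?V u - ?V u)) (at_right u)"
    using rc(1) u by (intro tendsto_intros) (auto simp: nondecreasing_rc_def)
  then have "((\<lambda>r. c * (?V r - ?V u)) \<longlongrightarrow> 0) (at_right u)" by simp
  with le have "((\<lambda>r. LS_integral v g r - LS_integral v g u) \<longlongrightarrow> 0) (at_right u)"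
    by (rule Lim_transform_bound)
  then show ?thesis by (rule iffD2[OF Lim_null])
qed

end

text \<open>By the Jordan decomposition \<open>g\<close> is the difference of two nondecreasing functions, and these have left
limits.\<close>

lemma finite_variation_left_limit:
  assumes g: "finite_variation g" and t: "0 < t"
  shows "\<exists>l. (g \<longlongrightarrow> l) (at_left t)"
proof -
  have left_limit: "\<exists>l. (A \<longlongrightarrow> l) (at_left t)" if A: "mono_on {0..} A" for A :: "real \<Rightarrow> real"
  proof (intro exI increasing_tendsto)
    let ?l = "SUP s\<in>{0..<t}. A s"
    have bdd: "bdd_above (A ` {0..<t})"
      using t by (intro bdd_aboveI2[where M = "A t"] mono_onD[OF A]) auto
    have ev: "\<forall>\<^sub>F s in at_left t. a < s \<and> s < t" if "a < t" for a
      using order_tendstoD(1)[OF tendsto_ident_at that, of "{..<t}"]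
      by (auto simp: eventually_at_filter elim: eventually_mono)
    show "\<forall>\<^sub>F s in at_left t. A s \<le> ?l"
      using ev[OF t] by eventually_elim (auto intro: cSUP_upper bdd)
    fix z assume "z < ?l"
    then obtain a where a: "0 \<le> a" "a < t" "z < A a"
      using t bdd by (subst (asm) less_cSUP_iff) auto
    show "\<forall>\<^sub>F s in at_left t. z < A s"
      using ev[OF a(2)]
    proof eventually_elim
      case (elim s)
      then have "A a \<le> A s" using a by (intro mono_onD[OF A]) auto
      with a(3) show ?case by (rule less_le_trans)
    qed
  qed
  note inc = abs_increment_le_total_variation[OF g]
  have "mono_on {0..} (pos_variation g)" "mono_on {0..} (neg_variation g)"
    unfolding pos_variation_def neg_variation_def by (auto intro!: mono_onI dest: inc)
  then obtain p n where "(pos_variation g \<longlongrightarrow> p) (at_left t)" "(neg_variation g \<longlongrightarrow> n) (at_left t)"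
    using left_limit by meson
  then have "((\<lambda>s. g 0 + pos_variation g s - neg_variation g s) \<longlongrightarrow> g 0 + p - n) (at_left t)"
    by (intro tendsto_intros)
  moreover have "(\<lambda>s. g 0 + pos_variation g s - neg_variation g s) = g"
    by (auto simp: pos_variation_def neg_variation_def field_simps)
  ultimately show ?thesis by auto
qed

text \<open>Variation sums of \<open>u \<mapsto> \<integral>\<^sub>0\<^sup>u v\<^sub>\<epsilon> dY\<^sub>\<epsilon>\<close> are bounded by \<open>\<integral> |v\<^sub>\<epsilon>| |dY\<^sub>\<epsilon>|\<close>, uniformly in \<open>\<epsilon>\<close>, and this bound
passes to the pointwise limit. Right-continuity passes to the uniform limit, and left limits exist
by finite variation. For the bracket of the main theorem this is what gives a meaning to integrals
against it.\<close>

proposition finite_variation_path_limit: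
  fixes Y v :: "real \<Rightarrow> real \<Rightarrow> real"
  assumes Y: "\<And>\<epsilon>. \<epsilon> > 0 \<Longrightarrow> finite_variation_path (Y \<epsilon>)"
    and v: "\<And>\<epsilon> u. \<epsilon> > 0 \<Longrightarrow> bounded_borel u (v \<epsilon>)"
    and bound: "\<And>u. u > 0 \<Longrightarrow> \<exists>C. \<forall>\<epsilon>>0. tv_integral (\<lambda>s. \<bar>v \<epsilon> s\<bar>) (Y \<epsilon>) u \<le> C"
    and lim: "\<And>u. u > 0 \<Longrightarrow> uniform_limit {0..u} (\<lambda>\<epsilon>. LS_integral (v \<epsilon>) (Y \<epsilon>)) B (at_right 0)"
  shows "finite_variation_path B"
proof -
  have fv: "finite_variation B"
    unfolding finite_variation_def
  proof (intro allI impI)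
    fix t :: real assume t: "0 \<le> t"
    obtain C where C: "\<forall>\<epsilon>>0. tv_integral (\<lambda>s. \<bar>v \<epsilon> s\<bar>) (Y \<epsilon>) (t + 1) \<le> C"
      using bound[of "t + 1"] t by auto
    show "bdd_above (variation_sums B t)"
    proof (rule bdd_aboveI)
      fix S assume "S \<in> variation_sums B t"
      then obtain p :: "nat \<Rightarrow> real" and n where p: "mono_on {..n} p" "p ` {..n} \<subseteq> {0..t}"
        and S: "S = (\<Sum>i<n. \<bar>B (p (Suc i)) - B (p i)\<bar>)"
        by (auto simp: variation_sums_def)
      let ?G = "\<lambda>\<epsilon>. LS_integral (v \<epsilon>) (Y \<epsilon>)"
      have pt: "p i \<in> {0..t + 1}" if "i \<le> n" for i
        using p(2) that by (force simp: image_subset_iff)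
      have "((\<lambda>\<epsilon>. \<Sum>i<n. \<bar>?G \<epsilon> (p (Suc i)) - ?G \<epsilon> (p i)\<bar>) \<longlongrightarrow> S) (at_right 0)"
        unfolding S using t
        by (intro tendsto_sum tendsto_rabs tendsto_diff tendsto_uniform_limitI[OF lim[of "t + 1"]] pt) auto
      moreover have "\<forall>\<^sub>F \<epsilon> in at_right 0. (\<Sum>i<n. \<bar>?G \<epsilon> (p (Suc i)) - ?G \<epsilon> (p i)\<bar>) \<le> C"
        using eventually_at_right_less[of "0::real"]
      proof eventually_elim
        case (elim \<epsilon>)
        interpret Y: finite_variation_path "Y \<epsilon>" using Y elim by simp
        let ?A = "tv_integral (\<lambda>s. \<bar>v \<epsilon> s\<bar>) (Y \<epsilon>)"
        have mono: "?A a \<le> ?A b" if "0 \<le> a" "a \<le> b" "b \<le> t + 1" for a b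
          using Y.LS_integral_increment_le[OF v[OF elim] that] by linarith
        have "(\<Sum>i<n. \<bar>?G \<epsilon> (p (Suc i)) - ?G \<epsilon> (p i)\<bar>) \<le> (\<Sum>i<n. ?A (p (Suc i)) - ?A (p i))"
          using p(1) pt by (intro sum_mono Y.LS_integral_increment_le[OF v[OF elim, of "t + 1"]])
            (auto simp: mono_on_def)
        also have "\<dots> = ?A (p n) - ?A (p 0)" by (rule sum_lessThan_telescope)
        also have "\<dots> \<le> ?A (t + 1)"
        proof -
          have "?A 0 = 0" by (simp add: tv_integral_def set_lebesgue_integral_def)
          then show ?thesis using mono[of "p n" "t + 1"] mono[of 0 "p 0"] pt[of n] pt[of 0] by simp
        qed
        also have "\<dots> \<le> C" using C elim by simp
        finally show ?case .
      qed
      ultimately show "S \<le> C" by (rule tendsto_upperbound) simp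
    qed
  qed
  have "(B \<longlongrightarrow> B u) (at_right u)" if u: "0 \<le> u" for u
  proof (rule swap_uniform_limit')
    show "\<forall>\<^sub>F \<epsilon> in at_right 0. (LS_integral (v \<epsilon>) (Y \<epsilon>) \<longlongrightarrow> LS_integral (v \<epsilon>) (Y \<epsilon>) u) (at_right u)"
      using eventually_at_right_less[of "0::real"]
    proof eventually_elim
      case (elim \<epsilon>)
      show ?case
        using finite_variation_path.LS_integral_right_continuous[OF Y[OF elim] v[OF elim], of u "u + 1"] u
        by simp
    qed
    show "((\<lambda>\<epsilon>. LS_integral (v \<epsilon>) (Y \<epsilon>) u) \<longlongrightarrow> B u) (at_right 0)"
      by (rule tendsto_uniform_limitI[OF lim[of "u + 1"]]) (use u in auto)
    show "uniform_limit {0..u + 1} (\<lambda>\<epsilon>. LS_integral (v \<epsilon>) (Y \<epsilon>)) B (at_right 0)"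
      using u by (intro lim) auto
    have "\<forall>\<^sub>F s in at_right u. s < u + 1" by (rule order_tendstoD(2)[OF tendsto_ident_at]) simp
    then show "\<forall>\<^sub>F s in at_right u. s \<in> {0..u + 1}"
      using eventually_at_right_less[of u] by eventually_elim (use u in auto)
  qed simp
  then have "cadlag B" using finite_variation_left_limit[OF fv] by (auto simp: cadlag_def)
  then show ?thesis using fv by unfold_locales
qed

section \<open>Uniform approximation by step functions\<close>

text \<open>Step functions as lists of triples \<open>(c, l, r)\<close>, each standing for the value \<open>c\<close> on \<open>(l, r]\<close>. Lists make
the concatenation of approximations on adjacent intervals immediate.\<close>

definition step_fun :: "(real \<times> real \<times> real) list \<Rightarrow> real \<Rightarrow> real" where
  "step_fun xs s = (\<Sum>(c, l, r)\<leftarrow>xs. c * indicator {l<..r} s)"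

lemma step_fun_simps [simp]:
  "step_fun [] s = 0"
  "step_fun ((c, l, r) # xs) s = c * indicator {l<..r} s + step_fun xs s"
  "step_fun (xs @ ys) s = step_fun xs s + step_fun ys s"
  by (simp_all add: step_fun_def)

definition intervals_in :: "real \<Rightarrow> real \<Rightarrow> (real \<times> real \<times> real) list \<Rightarrow> bool" where
  "intervals_in a b xs \<longleftrightarrow> (\<forall>(c, l, r)\<in>set xs. a \<le> l \<and> l \<le> r \<and> r \<le> b)"

lemma step_fun_outside:
  assumes "intervals_in a b xs" "s \<le> a \<or> b < s"
  shows "step_fun xs s = 0"
  using assms by (induction xs) (auto simp: intervals_in_def indicator_def)

text \<open>Near \<open>x\<close> the left limits of \<open>w\<close> are within \<open>\<eta>\<close> of the left limit at \<open>x\<close> before and at \<open>x\<close>, and within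
\<open>\<eta>\<close> of \<open>w x\<close> after \<open>x\<close>; bisection glues these two-step approximations together. The approximation is
uniform, unlike the one by Riemann sums, which is needed when the integrator varies as well.\<close>

lemma left_lim_step_approximation:
  assumes w: "cadlag w" and \<eta>: "0 < \<eta>" and t: "0 \<le> t"
  obtains xs where "intervals_in 0 t xs" "\<And>s. s \<in> {0<..t} \<Longrightarrow> \<bar>left_lim w s - step_fun xs s\<bar> \<le> \<eta>"
proof -
  let ?P = "\<lambda>a b. 0 \<le> a \<longrightarrow> (\<exists>xs. intervals_in a b xs \<and> (\<forall>s\<in>{a<..b}. \<bar>left_lim w s - step_fun xs s\<bar> \<le> \<eta>))"
  have "?P 0 t"
    using t
  proof (induction rule: Bolzano[where P = ?P])
    case (trans a b c)
    show ?case
    proof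
      assume "0 \<le> a"
      then obtain xs ys where xs: "intervals_in a b xs" "\<forall>s\<in>{a<..b}. \<bar>left_lim w s - step_fun xs s\<bar> \<le> \<eta>"
        and ys: "intervals_in b c ys" "\<forall>s\<in>{b<..c}. \<bar>left_lim w s - step_fun ys s\<bar> \<le> \<eta>"
        using trans by (meson order_trans)
      have "intervals_in a c (xs @ ys)"
        using xs(1) ys(1) trans(3,4) by (fastforce simp: intervals_in_def)
      moreover have "\<bar>left_lim w s - step_fun (xs @ ys) s\<bar> \<le> \<eta>" if "s \<in> {a<..c}" for s
        using xs(2) ys(2) step_fun_outside[OF xs(1), of s] step_fun_outside[OF ys(1), of s] that
        by (cases "s \<le> b") auto
      ultimately show "\<exists>xs. intervals_in a c xs \<and> (\<forall>s\<in>{a<..c}. \<bar>left_lim w s - step_fun xs s\<bar> \<le> \<eta>)"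
        by blast
    qed
  next
    case (local x)
    obtain d where d: "0 < d" "\<And>s. x < s \<Longrightarrow> s < x + d \<Longrightarrow> \<bar>w s - w x\<bar> < \<eta>"
      "\<And>s. 0 \<le> s \<Longrightarrow> x - d < s \<Longrightarrow> s < x \<Longrightarrow> \<bar>w s - left_lim w x\<bar> < \<eta>"
      by (rule cadlag_near[OF w local(1) \<eta>]) (rule that)
    show ?case
    proof (rule exI[of _ d], intro conjI allI impI d(1))
      fix a b assume ab: "a \<le> x \<and> x \<le> b \<and> b - a < d" and "0 \<le> a"
      let ?xs = "[(left_lim w x, a, x), (w x, x, b)]"
      have "intervals_in a b ?xs" using ab by (auto simp: intervals_in_def)
      moreover have "\<bar>left_lim w s - step_fun ?xs s\<bar> \<le> \<eta>" if s: "s \<in> {a<..b}" for s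
      proof (cases s x rule: linorder_cases)
        case less
        have "\<bar>left_lim w s - left_lim w x\<bar> \<le> \<eta>"
          by (rule left_lim_dist_le[OF w, where a = "x - d"])
             (use d(3) s ab less \<open>0 \<le> a\<close> in \<open>auto intro: less_imp_le\<close>)
        then show ?thesis using less s by (simp add: indicator_def)
      next
        case equal
        then show ?thesis using \<eta> s by (simp add: indicator_def)
      next
        case greater
        have "\<bar>left_lim w s - w x\<bar> \<le> \<eta>"
          by (rule left_lim_dist_le[OF w, where a = x])
             (use d(2) s ab greater \<open>0 \<le> a\<close> in \<open>auto intro: less_imp_le\<close>)
        then show ?thesis using greater s by (simp add: indicator_def)
      qed
      ultimately show "\<exists>xs. intervals_in a b xs \<and> (\<forall>s\<in>{a<..b}. \<bar>left_lim w s - step_fun xs s\<bar> \<le> \<eta>)"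
        by blast
    qed
  qed
  then show ?thesis using that by auto
qed

lemma bounded_borel_step_fun: "bounded_borel t (step_fun xs)"
proof (induction xs)
  case (Cons x xs)
  then show ?case
    by (cases x) (auto intro!: bounded_borel_add bounded_borel_mult bounded_borel_indicator simp: fun_eq_iff)
qed simp

lemma (in finite_variation_path) LS_integral_step_fun:
  assumes v: "bounded_borel t v" and xs: "intervals_in 0 t xs" and t: "0 \<le> t"
  shows "LS_integral (\<lambda>s. v s * step_fun xs s) g t =
    (\<Sum>(c, l, r)\<leftarrow>xs. c * (LS_integral v g r - LS_integral v g l))"
  using xs
proof (induction xs)
  case Nil
  then show ?case by (simp add: LS_integral_def)
next
  case (Cons x xs)
  obtain c l r where x: "x = (c, l, r)" by (cases x)
  have lr: "0 \<le> l" "l \<le> r" "r \<le> t" and xs: "intervals_in 0 t xs"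
    using Cons.prems by (auto simp: intervals_in_def x)
  have "LS_integral (\<lambda>s. v s * step_fun (x # xs) s) g t =
      LS_integral (\<lambda>s. c * (v s * indicator {l<..r} s) + v s * step_fun xs s) g t"
    by (simp add: x algebra_simps)
  also have "\<dots> = LS_integral (\<lambda>s. c * (v s * indicator {l<..r} s)) g t + LS_integral (\<lambda>s. v s * step_fun xs s) g t"
    by (intro LS_integral_add bounded_borel_mult bounded_borel_const v bounded_borel_indicator
        bounded_borel_step_fun t) auto
  finally show ?case
    by (simp only: LS_integral_mult_left LS_integral_over_Ioc[OF v lr] Cons.IH[OF xs]) (simp add: x)
qed

text \<open>Convergence of the integrals over \<open>(0, u]\<close> for each \<open>u\<close> gives convergence for step functions. The
total masses of the signed measures \<open>v\<^sub>\<epsilon> dY\<^sub>\<epsilon>\<close> are bounded uniformly in \<open>\<epsilon>\<close>, so uniform approximation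
by step functions extends it to all left limits of cadlag paths.\<close>

proposition LS_integral_limit:
  fixes Y v :: "real \<Rightarrow> real \<Rightarrow> real"
  assumes Y: "\<And>\<epsilon>. \<epsilon> > 0 \<Longrightarrow> finite_variation_path (Y \<epsilon>)"
    and v: "\<And>\<epsilon>. \<epsilon> > 0 \<Longrightarrow> bounded_borel t (v \<epsilon>)"
    and bound: "\<And>\<epsilon>. \<epsilon> > 0 \<Longrightarrow> tv_integral (\<lambda>s. \<bar>v \<epsilon> s\<bar>) (Y \<epsilon>) t \<le> C"
    and B: "finite_variation_path B"
    and lim: "\<And>u. u \<in> {0..t} \<Longrightarrow> ((\<lambda>\<epsilon>. LS_integral (v \<epsilon>) (Y \<epsilon>) u) \<longlongrightarrow> B u) (at_right 0)"
    and w: "cadlag w" and t: "0 < t"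
  shows "((\<lambda>\<epsilon>. LS_integral (\<lambda>s. v \<epsilon> s * left_lim w s) (Y \<epsilon>) t) \<longlongrightarrow> LS_integral (left_lim w) B t) (at_right 0)"
proof (rule tendstoI)
  fix e :: real assume e: "0 < e"
  interpret B: finite_variation_path B by fact
  have t0: "0 \<le> t" using t by simp
  let ?V = "total_variation B t"
  have V: "0 \<le> ?V" using abs_increment_le_total_variation[OF B.finite_variation, of 0 t] t
    by (simp add: total_variation_0)
  define \<eta> where "\<eta> = e / (2 * (\<bar>C\<bar> + ?V + 1))"
  have \<eta>: "0 < \<eta>" using e V by (simp add: \<eta>_def)
  have \<eta>_le: "\<eta> * C + \<eta> * ?V \<le> e / 2"
  proof -
    have "\<eta> * C + \<eta> * ?V \<le> \<eta> * (\<bar>C\<bar> + ?V + 1)"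
      unfolding distrib_left[symmetric] using \<eta> by (intro mult_left_mono) auto
    also have "\<dots> = e / 2" using V by (simp add: \<eta>_def field_simps)
    finally show ?thesis .
  qed
  obtain xs where xs: "intervals_in 0 t xs" "\<And>s. s \<in> {0<..t} \<Longrightarrow> \<bar>left_lim w s - step_fun xs s\<bar> \<le> \<eta>"
    using left_lim_step_approximation[OF w \<eta> t0] by metis
  have bb: "bounded_borel t (left_lim w)" "bounded_borel t (step_fun xs)"
    by (rule bounded_borel_cadlag[OF w] bounded_borel_step_fun)+
  let ?S = "\<lambda>G. \<Sum>(c, l, r)\<leftarrow>xs. c * (G r - G l :: real)"
  have SB: "LS_integral (step_fun xs) B t = ?S B"
  proof -
    have G: "LS_integral (\<lambda>_. 1) B u = B u - B 0" if "0 \<le> u" for u using B.LS_integral_1 that by simp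
    have "?S (LS_integral (\<lambda>_. 1) B) = ?S B"
      by (rule arg_cong[where f = sum_list], rule map_cong) (use xs(1) in \<open>auto simp: intervals_in_def G\<close>)
    then show ?thesis using B.LS_integral_step_fun[OF bounded_borel_const xs(1) t0, of 1] by simp
  qed
  have "((\<lambda>\<epsilon>. ?S (LS_integral (v \<epsilon>) (Y \<epsilon>))) \<longlongrightarrow> ?S B) (at_right 0)"
    using xs(1)
  proof (induction xs)
    case (Cons x xs)
    obtain c l r where x: "x = (c, l, r)" by (cases x)
    have "((\<lambda>\<epsilon>. c * (LS_integral (v \<epsilon>) (Y \<epsilon>) r - LS_integral (v \<epsilon>) (Y \<epsilon>) l)) \<longlongrightarrow> c * (B r - B l)) (at_right 0)"
      by (intro tendsto_intros lim) (use Cons.prems in \<open>auto simp: x intervals_in_def\<close>)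
    then show ?case using Cons by (auto simp: x intervals_in_def intro!: tendsto_add)
  qed simp
  from tendstoD[OF this, of "e / 2"]
  have "\<forall>\<^sub>F \<epsilon> in at_right 0. \<bar>?S (LS_integral (v \<epsilon>) (Y \<epsilon>)) - ?S B\<bar> < e / 2"
    using e unfolding dist_real_def by simp
  then show "\<forall>\<^sub>F \<epsilon> in at_right 0. dist (LS_integral (\<lambda>s. v \<epsilon> s * left_lim w s) (Y \<epsilon>) t) (LS_integral (left_lim w) B t) < e"
    using eventually_at_right_less[of "0::real"]
  proof eventually_elim
    case (elim \<epsilon>)
    interpret Y: finite_variation_path "Y \<epsilon>" using Y elim by simp
    note v = v[OF elim(2)]
    have "\<bar>LS_integral (\<lambda>s. v \<epsilon> s * left_lim w s) (Y \<epsilon>) t - ?S (LS_integral (v \<epsilon>) (Y \<epsilon>))\<bar> =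
        \<bar>LS_integral (\<lambda>s. v \<epsilon> s * left_lim w s - v \<epsilon> s * step_fun xs s) (Y \<epsilon>) t\<bar>"
      using Y.LS_integral_diff[OF bounded_borel_mult[OF v bb(1)] bounded_borel_mult[OF v bb(2)] t0]
        Y.LS_integral_step_fun[OF v xs(1) t0] by simp
    also have "\<dots> \<le> tv_integral (\<lambda>s. \<bar>v \<epsilon> s * left_lim w s - v \<epsilon> s * step_fun xs s\<bar>) (Y \<epsilon>) t"
      by (intro Y.abs_LS_integral_le bounded_borel_intros v bb t0)
    also have "\<dots> \<le> tv_integral (\<lambda>s. \<eta> * \<bar>v \<epsilon> s\<bar>) (Y \<epsilon>) t"
    proof (rule Y.tv_integral_mono)
      fix s assume "s \<in> {0<..t}"
      then have "\<bar>v \<epsilon> s\<bar> * \<bar>left_lim w s - step_fun xs s\<bar> \<le> \<bar>v \<epsilon> s\<bar> * \<eta>"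
        using xs(2) by (intro mult_left_mono) auto
      then show "\<bar>v \<epsilon> s * left_lim w s - v \<epsilon> s * step_fun xs s\<bar> \<le> \<eta> * \<bar>v \<epsilon> s\<bar>"
        by (simp add: abs_mult[symmetric] right_diff_distrib mult.commute)
    qed (intro bounded_borel_intros v bb t0)+
    also have "\<dots> \<le> \<eta> * C"
      unfolding tv_integral_mult_left using bound[OF elim(2)] \<eta> by (intro mult_left_mono) auto
    finally have 1: "\<bar>LS_integral (\<lambda>s. v \<epsilon> s * left_lim w s) (Y \<epsilon>) t - ?S (LS_integral (v \<epsilon>) (Y \<epsilon>))\<bar> \<le> \<eta> * C" .
    have "\<bar>LS_integral (left_lim w) B t - ?S B\<bar> = \<bar>LS_integral (\<lambda>s. left_lim w s - step_fun xs s) B t\<bar>"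
      using B.LS_integral_diff[OF bb t0] by (simp add: SB)
    also have "\<dots> \<le> tv_integral (\<lambda>s. \<bar>left_lim w s - step_fun xs s\<bar>) B t"
      by (intro B.abs_LS_integral_le bounded_borel_intros bb t0)
    also have "\<dots> \<le> tv_integral (\<lambda>_. \<eta>) B t"
      by (intro B.tv_integral_mono bounded_borel_intros bb t0 xs(2))
    also have "\<dots> = \<eta> * ?V" by (rule B.tv_integral_const[OF t0])
    finally have "\<bar>LS_integral (left_lim w) B t - ?S B\<bar> \<le> \<eta> * ?V" .
    with 1 elim(1) \<eta>_le show ?case unfolding dist_real_def by linarith
  qed
qed

section \<open>The integral by parts for one approximating path\<close>

locale C2_function = F: C1_function F f + f: C1_function f f' for F f f' :: "real \<Rightarrow> real"
begin

lemma diff_quotient_expansion: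
  obtains C where "C \<ge> 0" "\<And>a b. \<bar>a\<bar> \<le> r \<Longrightarrow> \<bar>b\<bar> \<le> r \<Longrightarrow> \<bar>diff_quotient F f a b - f a\<bar> \<le> C * \<bar>b - a\<bar>"
proof -
  obtain C where C: "C \<ge> 0" "\<And>a b. \<bar>a\<bar> \<le> r \<Longrightarrow> \<bar>b\<bar> \<le> r \<Longrightarrow> \<bar>diff_quotient f f' a b\<bar> \<le> C"
    by (rule f.diff_quotient_bounded) (rule that)
  have "\<bar>diff_quotient F f a b - f a\<bar> \<le> C * \<bar>b - a\<bar>" if ab: "\<bar>a\<bar> \<le> r" "\<bar>b\<bar> \<le> r" for a b
  proof -
    obtain \<xi> where \<xi>: "min a b \<le> \<xi>" "\<xi> \<le> max a b" "diff_quotient F f a b = f \<xi>"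
      by (rule F.diff_quotient_mean_value) (rule that)
    have "\<bar>diff_quotient F f a b - f a\<bar> = \<bar>diff_quotient f f' a \<xi>\<bar> * \<bar>\<xi> - a\<bar>"
      unfolding \<xi>(3) abs_mult[symmetric] diff_quotient_mult ..
    also have "\<dots> \<le> C * \<bar>b - a\<bar>"
      using \<xi>(1,2) ab C(1) by (intro mult_mono C(2)) auto
    finally show ?thesis .
  qed
  with C(1) show ?thesis by (rule that)
qed

text \<open>The second-order Taylor remainder at a jump, as the jump of \<open>y\<close> times an integrand of the form to
which \<open>has_sum_jumps\<close> applies.\<close>

lemma taylor_remainder_eq:
  "(diff_quotient F f (left_lim y s) (y s) - f (left_lim y s)) * jump y s =
    F (y s) - F (left_lim y s) - f (left_lim y s) * jump y s"
  using diff_quotient_mult[of F f "left_lim y s" "y s"] by (simp add: jump_def left_diff_distrib)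

text \<open>The integral \<open>\<integral> x\<^bsub>s-\<^esub> df(y)\<close> and the sum over common jumps in the definition of the integral combine
to \<open>\<integral> x df(y)\<close>. Splitting \<open>x = y + (x - y)\<close>, the part with \<open>y\<close> turns into \<open>\<integral> f(y\<^bsub>s-\<^esub>) dy\<close> by integration
by parts, hence into the increment of \<open>F(y)\<close> minus the jump sum, and the part with \<open>x - y\<close> is
rewritten by the chain rule. What is left besides the terms of Ito's formula for \<open>y\<close> is a boundary
term and the integral of \<open>x - y\<close>, from which the bracket arises.\<close>

proposition parts_integral_formula:
  assumes y: "finite_variation_path y" and x: "cadlag x" and t: "0 < t"
  shows "parts_integral f y x t =
      F (y t) - F (y 0) + (f (y t) * (x t - y t) - f (y 0) * (x 0 - y 0))
      - LS_integral (\<lambda>s. (x s - y s) * diff_quotient f f' (left_lim y s) (y s)) y t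
      - (\<Sum>\<^sub>\<infinity>s\<in>{0<..t}. F (y s) - F (left_lim y s) - f (left_lim y s) * jump y s)"
    and "(\<lambda>s. jump x s * (f (y s) - f (left_lim y s))) summable_on {0<..t}"
    and "LS_integrable (left_lim x) (\<lambda>s. f (y s)) t"
proof -
  interpret y: finite_variation_path y by fact
  interpret g: finite_variation_path "\<lambda>s. f (y s)" by (rule f.finite_variation_path_compose[OF y])
  have t0: "0 \<le> t" using t by simp
  let ?g = "\<lambda>s. f (y s)"
  note left_lim_g = left_lim_compose[OF f.continuous y.cadlag]
  note bb = bounded_borel_cadlag[OF x] bounded_borel_cadlag[OF y.cadlag] bounded_borel_cadlag[OF g.cadlag]
  have v: "cadlag (\<lambda>s. x s - y s)" by (rule cadlag_diff[OF x y.cadlag])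
  show "LS_integrable (left_lim x) (\<lambda>s. f (y s)) t"
    unfolding LS_integrable_def tv_measure_def
    by (intro conjI g.cadlag g.finite_variation set_integrable_stieltjes g.rc bb t0)

  have "((\<lambda>s. jump x s * jump ?g s) has_sum LS_integral (\<lambda>s. jump x s) ?g t) {0<..t}"
    by (rule g.has_sum_jumps[OF _ x zero_le_one _ t0])
       (auto simp: jump_def[abs_def] intro!: bounded_borel_diff bb)
  also have "?this \<longleftrightarrow> ((\<lambda>s. jump x s * (f (y s) - f (left_lim y s))) has_sum LS_integral (\<lambda>s. jump x s) ?g t) {0<..t}"
    by (rule has_sum_cong) (simp add: jump_def[of ?g] left_lim_g)
  finally have sum_x: "((\<lambda>s. jump x s * (f (y s) - f (left_lim y s))) has_sum LS_integral (\<lambda>s. jump x s) ?g t) {0<..t}" .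
  then show "(\<lambda>s. jump x s * (f (y s) - f (left_lim y s))) summable_on {0<..t}"
    by (rule has_sum_imp_summable)

  have "LS_integral x ?g t = LS_integral (left_lim x) ?g t + LS_integral (\<lambda>s. jump x s) ?g t"
    unfolding jump_def by (subst g.LS_integral_add[symmetric]) (auto intro!: bounded_borel_diff bb t0)
  moreover have "LS_integral x ?g t = LS_integral y ?g t + LS_integral (\<lambda>s. x s - y s) ?g t"
    by (subst g.LS_integral_add[symmetric]) (auto intro!: bounded_borel_diff bb t0)
  moreover have "LS_integral y ?g t + LS_integral (\<lambda>s. f (left_lim y s)) y t = y t * f (y t) - y 0 * f (y 0)"
    using integration_by_parts[OF g.finite_variation_path_axioms y t]
      LS_integral_cong[of t "left_lim ?g" "\<lambda>s. f (left_lim y s)" y] left_lim_g by simp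
  moreover have "LS_integral (\<lambda>s. x s - y s) ?g t =
      LS_integral (\<lambda>s. (x s - y s) * diff_quotient f f' (left_lim y s) (y s)) y t"
    by (rule f.chain_rule[OF y v t])
  ultimately have P: "parts_integral f y x t =
      f (y t) * (x t - y t) - f (y 0) * (x 0 - y 0) + LS_integral (\<lambda>s. f (left_lim y s)) y t
      - LS_integral (\<lambda>s. (x s - y s) * diff_quotient f f' (left_lim y s) (y s)) y t"
    unfolding parts_integral_def infsumI[OF sum_x] by (simp add: algebra_simps)

  let ?k = "\<lambda>s. diff_quotient F f (left_lim y s) (y s) - f (left_lim y s)"
  have f_left: "bounded_borel t (\<lambda>s. f (left_lim y s))"
    using bb(6)[of t] by (rule iffD1[OF bounded_borel_cong, rotated]) (simp add: left_lim_g)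
  have q: "bounded_borel t (\<lambda>s. diff_quotient F f (left_lim y s) (y s))"
    by (rule F.bounded_borel_diff_quotient[OF y.cadlag t])
  obtain r where r: "\<And>s. 0 \<le> s \<Longrightarrow> s \<le> t \<Longrightarrow> \<bar>y s\<bar> \<le> r" "\<And>s. 0 < s \<Longrightarrow> s \<le> t \<Longrightarrow> \<bar>left_lim y s\<bar> \<le> r"
    using cadlag_bounded[OF y.cadlag, of t] by metis
  obtain C where C: "C \<ge> 0" "\<And>a b. \<bar>a\<bar> \<le> r \<Longrightarrow> \<bar>b\<bar> \<le> r \<Longrightarrow> \<bar>diff_quotient F f a b - f a\<bar> \<le> C * \<bar>b - a\<bar>"
    by (rule diff_quotient_expansion) (rule that)
  have "((\<lambda>s. ?k s * jump y s) has_sum LS_integral ?k y t) {0<..t}"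
  proof (rule y.has_sum_jumps[OF _ y.cadlag C(1) _ t0])
    show "\<bar>?k s\<bar> \<le> C * \<bar>jump y s\<bar>" if "s \<in> {0<..t}" for s
      unfolding jump_def using that by (intro C(2) r) auto
  qed (intro bounded_borel_diff f_left q)
  then have "LS_integral ?k y t = (\<Sum>\<^sub>\<infinity>s\<in>{0<..t}. F (y s) - F (left_lim y s) - f (left_lim y s) * jump y s)"
    unfolding taylor_remainder_eq by (rule infsumI[symmetric])
  moreover have "LS_integral ?k y t = F (y t) - F (y 0) - LS_integral (\<lambda>s. f (left_lim y s)) y t"
    unfolding F.fundamental_theorem[OF y t] by (rule y.LS_integral_diff[OF q f_left t0])
  ultimately show "parts_integral f y x t =
      F (y t) - F (y 0) + (f (y t) * (x t - y t) - f (y 0) * (x 0 - y 0))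
      - LS_integral (\<lambda>s. (x s - y s) * diff_quotient f f' (left_lim y s) (y s)) y t
      - (\<Sum>\<^sub>\<infinity>s\<in>{0<..t}. F (y s) - F (left_lim y s) - f (left_lim y s) * jump y s)"
    using P by simp
qed

end

section \<open>Passage to the limit\<close>

lemma left_lim_close:
  assumes "cadlag x" "cadlag y" "0 < s" "\<And>u. 0 \<le> u \<Longrightarrow> \<bar>x u - y u\<bar> \<le> \<epsilon>"
  shows "\<bar>left_lim x s - left_lim y s\<bar> \<le> \<epsilon>"
  using left_lim_dist_le[OF cadlag_diff[OF assms(1,2)] assms(3), of "-1" 0 \<epsilon>] assms
  by (simp add: left_lim_diff)

text \<open>Tannery's theorem for unordered sums: the partial sums converge uniformly by the Weierstrass test,
so the limit in \<open>\<epsilon>\<close> and the limit over finite subsets can be exchanged.\<close>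

lemma infsum_dominated_convergence:
  fixes h :: "'b \<Rightarrow> 'a \<Rightarrow> real"
  assumes g: "g summable_on A" and le: "\<And>\<epsilon> s. \<epsilon> \<in> Y \<Longrightarrow> s \<in> A \<Longrightarrow> \<bar>h \<epsilon> s\<bar> \<le> g s"
    and lim: "\<And>s. s \<in> A \<Longrightarrow> ((\<lambda>\<epsilon>. h \<epsilon> s) \<longlongrightarrow> k s) G"
    and Y: "\<forall>\<^sub>F \<epsilon> in G. \<epsilon> \<in> Y" and G: "G \<noteq> bot"
  shows "((\<lambda>\<epsilon>. \<Sum>\<^sub>\<infinity>s\<in>A. h \<epsilon> s) \<longlongrightarrow> (\<Sum>\<^sub>\<infinity>s\<in>A. k s)) G" and "k summable_on A"
proof -
  have k: "norm (k s) \<le> g s" if s: "s \<in> A" for s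
  proof (rule tendsto_upperbound[OF tendsto_norm[OF lim[OF s]] _ G])
    show "\<forall>\<^sub>F \<epsilon> in G. norm (h \<epsilon> s) \<le> g s" using Y by eventually_elim (use le s in auto)
  qed
  show k_summable: "k summable_on A"
    by (rule abs_summable_summable, rule Infinite_Sum.abs_summable_on_comparison_test'[OF g k])
  show "((\<lambda>\<epsilon>. \<Sum>\<^sub>\<infinity>s\<in>A. h \<epsilon> s) \<longlongrightarrow> (\<Sum>\<^sub>\<infinity>s\<in>A. k s)) G"
  proof (rule swap_uniform_limit'[OF _ _ _ Y])
    show "\<forall>\<^sub>F B in finite_subsets_at_top A. ((\<lambda>\<epsilon>. \<Sum>s\<in>B. h \<epsilon> s) \<longlongrightarrow> (\<Sum>s\<in>B. k s)) G"
      unfolding eventually_finite_subsets_at_top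
      by (rule exI[of _ "{}"]) (auto intro!: tendsto_sum lim)
    show "((\<lambda>B. \<Sum>s\<in>B. k s) \<longlongrightarrow> (\<Sum>\<^sub>\<infinity>s\<in>A. k s)) (finite_subsets_at_top A)"
      by (rule infsum_tendsto[OF k_summable])
    show "uniform_limit Y (\<lambda>B \<epsilon>. \<Sum>s\<in>B. h \<epsilon> s) (\<lambda>\<epsilon>. \<Sum>\<^sub>\<infinity>s\<in>A. h \<epsilon> s) (finite_subsets_at_top A)"
      by (rule Weierstrass_m_test_general[OF _ g]) (use le in auto)
  qed simp
qed

locale approximated_path =
  fixes x :: "real \<Rightarrow> real" and X :: "real \<Rightarrow> real \<Rightarrow> real" and K :: real
  assumes x: "cadlag x"
    and X: "\<And>\<epsilon>. \<epsilon> > 0 \<Longrightarrow> finite_variation_path (X \<epsilon>)"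
    and close: "\<And>\<epsilon> s. \<epsilon> > 0 \<Longrightarrow> s \<ge> 0 \<Longrightarrow> \<bar>x s - X \<epsilon> s\<bar> \<le> \<epsilon>"
    and K: "K \<ge> 0" and jumps: "\<And>\<epsilon> s. \<epsilon> > 0 \<Longrightarrow> s > 0 \<Longrightarrow> \<bar>jump (X \<epsilon>) s\<bar> \<le> K * \<bar>jump x s\<bar>"
begin

lemma X_cadlag: "\<epsilon> > 0 \<Longrightarrow> cadlag (X \<epsilon>)"
  using X by (rule finite_variation_path.cadlag)

lemma left_close: "\<epsilon> > 0 \<Longrightarrow> s > 0 \<Longrightarrow> \<bar>left_lim x s - left_lim (X \<epsilon>) s\<bar> \<le> \<epsilon>"
  by (intro left_lim_close x X_cadlag close)

lemma tendsto_of_close: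
  assumes "\<And>\<epsilon>. \<epsilon> > 0 \<Longrightarrow> \<bar>a - b \<epsilon>\<bar> \<le> \<epsilon>"
  shows "(b \<longlongrightarrow> a) (at_right (0::real))"
proof (rule Lim_transform_bound[where g = "\<lambda>\<epsilon>. \<epsilon>", THEN iffD2[OF Lim_null]])
  show "\<forall>\<^sub>F \<epsilon> in at_right 0. norm (b \<epsilon> - a) \<le> norm \<epsilon>"
    using eventually_at_right_less[of "0::real"]
    by eventually_elim (use assms in \<open>auto simp: abs_minus_commute\<close>)
qed (rule tendsto_ident_at)

lemma X_tendsto: "s \<ge> 0 \<Longrightarrow> ((\<lambda>\<epsilon>. X \<epsilon> s) \<longlongrightarrow> x s) (at_right 0)"
  by (rule tendsto_of_close) (rule close)

lemma X_left_tendsto: "s > 0 \<Longrightarrow> ((\<lambda>\<epsilon>. left_lim (X \<epsilon>) s) \<longlongrightarrow> left_lim x s) (at_right 0)"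
  by (rule tendsto_of_close) (rule left_close)

lemma uniform_bound:
  obtains r where "\<And>s. 0 \<le> s \<Longrightarrow> s \<le> t \<Longrightarrow> \<bar>x s\<bar> \<le> r" "\<And>s. 0 < s \<Longrightarrow> s \<le> t \<Longrightarrow> \<bar>left_lim x s\<bar> \<le> r"
    "\<And>\<epsilon> s. 0 < \<epsilon> \<Longrightarrow> \<epsilon> < 1 \<Longrightarrow> 0 \<le> s \<Longrightarrow> s \<le> t \<Longrightarrow> \<bar>X \<epsilon> s\<bar> \<le> r"
    "\<And>\<epsilon> s. 0 < \<epsilon> \<Longrightarrow> \<epsilon> < 1 \<Longrightarrow> 0 < s \<Longrightarrow> s \<le> t \<Longrightarrow> \<bar>left_lim (X \<epsilon>) s\<bar> \<le> r"
proof -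
  obtain r where r: "\<And>s. 0 \<le> s \<Longrightarrow> s \<le> t \<Longrightarrow> \<bar>x s\<bar> \<le> r" "\<And>s. 0 < s \<Longrightarrow> s \<le> t \<Longrightarrow> \<bar>left_lim x s\<bar> \<le> r"
    using cadlag_bounded[OF x, of t] by metis
  show ?thesis
  proof (rule that[of "r + 1"])
    show "\<bar>x s\<bar> \<le> r + 1" if "0 \<le> s" "s \<le> t" for s using r(1)[OF that] by simp
    show "\<bar>left_lim x s\<bar> \<le> r + 1" if "0 < s" "s \<le> t" for s using r(2)[OF that] by simp
    show "\<bar>X \<epsilon> s\<bar> \<le> r + 1" if "0 < \<epsilon>" "\<epsilon> < 1" "0 \<le> s" "s \<le> t" for \<epsilon> s
      using r(1)[OF that(3,4)] close[OF that(1,3)] that by linarith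
    show "\<bar>left_lim (X \<epsilon>) s\<bar> \<le> r + 1" if "0 < \<epsilon>" "\<epsilon> < 1" "0 < s" "s \<le> t" for \<epsilon> s
      using r(2)[OF that(3,4)] left_close[OF that(1,3)] that by linarith
  qed
qed

text \<open>Replacing the difference quotient of \<open>f\<close> at \<open>(x\<^sup>\<epsilon>\<^bsub>s-\<^esub>, x\<^sup>\<epsilon>\<^sub>s)\<close> by \<open>f' (x\<^bsub>s-\<^esub>)\<close> costs nothing in the limit. Off
the finite set \<open>A\<close> of large jumps of \<open>x\<close> the two differ by less than \<open>\<eta>\<close>, by uniform continuity of
\<open>f'\<close> and because jumps of \<open>x\<^sup>\<epsilon>\<close> are dominated by those of \<open>x\<close>; the contribution is at most \<open>\<eta>\<close> times the
uniform bound on \<open>\<integral> |x - x\<^sup>\<epsilon>| |dx\<^sup>\<epsilon>|\<close>. On \<open>A\<close> the integral is a finite sum whose terms carry the factor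
\<open>|x\<^sub>s - x\<^sup>\<epsilon>\<^sub>s| \<le> \<epsilon>\<close>.\<close>

proposition remainder_tendsto_0:
  assumes f: "C1_function f f'" and t: "0 < t"
    and bound: "\<And>\<epsilon>. \<epsilon> > 0 \<Longrightarrow> tv_integral (\<lambda>s. \<bar>x s - X \<epsilon> s\<bar>) (X \<epsilon>) t \<le> C"
  shows "((\<lambda>\<epsilon>. LS_integral (\<lambda>s. (x s - X \<epsilon> s) *
      (diff_quotient f f' (left_lim (X \<epsilon>) s) (X \<epsilon> s) - f' (left_lim x s))) (X \<epsilon>) t) \<longlongrightarrow> 0) (at_right 0)"
proof (rule tendstoI)
  fix e :: real assume e: "0 < e"
  interpret f: C1_function f f' by fact
  have t0: "0 \<le> t" using t by simp
  obtain r where r: "\<And>s. 0 \<le> s \<Longrightarrow> s \<le> t \<Longrightarrow> \<bar>x s\<bar> \<le> r" "\<And>s. 0 < s \<Longrightarrow> s \<le> t \<Longrightarrow> \<bar>left_lim x s\<bar> \<le> r"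
    "\<And>\<epsilon> s. 0 < \<epsilon> \<Longrightarrow> \<epsilon> < 1 \<Longrightarrow> 0 \<le> s \<Longrightarrow> s \<le> t \<Longrightarrow> \<bar>X \<epsilon> s\<bar> \<le> r"
    "\<And>\<epsilon> s. 0 < \<epsilon> \<Longrightarrow> \<epsilon> < 1 \<Longrightarrow> 0 < s \<Longrightarrow> s \<le> t \<Longrightarrow> \<bar>left_lim (X \<epsilon>) s\<bar> \<le> r"
    by (rule uniform_bound) (rule that)
  obtain D where D: "D \<ge> 0" "\<And>u. \<bar>u\<bar> \<le> r \<Longrightarrow> \<bar>f' u\<bar> \<le> D" by (rule f.deriv_bounded) (rule that)
  define \<eta> where "\<eta> = e / (2 * (\<bar>C\<bar> + 1))"
  have \<eta>: "0 < \<eta>" using e by (simp add: \<eta>_def add_nonneg_pos)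
  have "\<eta> * C \<le> \<eta> * (\<bar>C\<bar> + 1)" using \<eta> by (intro mult_left_mono) auto
  also have "\<dots> = e / 2" by (simp add: \<eta>_def field_simps)
  finally have \<eta>C: "\<eta> * C \<le> e / 2" .
  have "uniformly_continuous_on {-r..r} f'"
    by (rule compact_uniformly_continuous[OF continuous_on_subset[OF f.cont]]) auto
  then obtain d where d: "d > 0" "\<And>u u'. u \<in> {-r..r} \<Longrightarrow> u' \<in> {-r..r} \<Longrightarrow> dist u' u < d \<Longrightarrow> dist (f' u') (f' u) < \<eta>"
    using \<eta> unfolding uniformly_continuous_on_def by metis
  \<comment> \<open>Jumps of \<open>x\<close> up to \<open>\<delta>\<close> force jumps of \<open>X \<epsilon>\<close> below \<open>d / 2\<close>; the other half of \<open>d\<close> absorbs the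
    distance between the two paths.\<close>
  define \<delta> where "\<delta> = d / (2 * (K + 1))"
  have \<delta>: "0 < \<delta>" using d K by (simp add: \<delta>_def)
  have K\<delta>: "K * \<delta> < d / 2"
  proof -
    have "K * \<delta> < (K + 1) * \<delta>" using \<delta> by simp
    also have "\<dots> = d / 2" using K by (simp add: \<delta>_def field_simps)
    finally show ?thesis .
  qed
  define A where "A = {s \<in> {0<..t}. \<delta> < \<bar>jump x s\<bar>}"
  have A: "finite A" "A \<subseteq> {0<..t}" unfolding A_def using finite_large_jumps[OF x \<delta>] by auto
  define S where "S = (\<Sum>s\<in>A. 2 * D * (K * \<bar>jump x s\<bar>))"
  have "((\<lambda>\<epsilon>. \<epsilon> * S) \<longlongrightarrow> 0 * S) (at_right 0)" by (intro tendsto_mult tendsto_ident_at tendsto_const)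
  then have "\<forall>\<^sub>F \<epsilon> in at_right 0. \<epsilon> * S < e / 2"
    by (rule order_tendstoD(2)) (use e in simp)
  moreover have "\<forall>\<^sub>F \<epsilon> in at_right 0. \<epsilon> < d / 2" "\<forall>\<^sub>F \<epsilon> in at_right (0::real). \<epsilon> < 1"
    using d by (intro order_tendstoD(2)[OF tendsto_ident_at]; simp)+
  ultimately show "\<forall>\<^sub>F \<epsilon> in at_right 0. dist (LS_integral (\<lambda>s. (x s - X \<epsilon> s) *
      (diff_quotient f f' (left_lim (X \<epsilon>) s) (X \<epsilon> s) - f' (left_lim x s))) (X \<epsilon>) t) 0 < e"
    using eventually_at_right_less[of "0::real"]
  proof eventually_elim
    case (elim \<epsilon>)
    interpret y: finite_variation_path "X \<epsilon>" using X elim by simp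
    let ?v = "\<lambda>s. x s - X \<epsilon> s"
    let ?k = "\<lambda>s. diff_quotient f f' (left_lim (X \<epsilon>) s) (X \<epsilon> s) - f' (left_lim x s)"
    let ?m = "\<lambda>s. ?v s * ?k s"
    have f'x: "bounded_borel t (\<lambda>s. f' (left_lim x s))"
      using bounded_borel_cadlag(2)[OF cadlag_compose[OF f.cont x]]
      by (rule iffD1[OF bounded_borel_cong, rotated]) (simp add: left_lim_compose[OF f.cont x])
    have v: "bounded_borel t ?v"
      by (rule bounded_borel_cadlag(1)[OF cadlag_diff[OF x y.cadlag]])
    have m: "bounded_borel t ?m"
      by (intro bounded_borel_mult[OF v] bounded_borel_diff f'x f.bounded_borel_diff_quotient y.cadlag t)
    have mA: "bounded_borel t (\<lambda>s. ?m s * indicator A s)"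
      using A by (intro bounded_borel_mult[OF m] bounded_borel_indicator) (auto intro: borel_closed finite_imp_closed)
    have k_mean: "\<exists>\<xi>. \<bar>\<xi>\<bar> \<le> r \<and> \<bar>\<xi> - left_lim (X \<epsilon>) s\<bar> \<le> \<bar>jump (X \<epsilon>) s\<bar> \<and> ?k s = f' \<xi> - f' (left_lim x s)"
      if s: "s \<in> {0<..t}" for s
    proof -
      obtain \<xi> where \<xi>: "min (left_lim (X \<epsilon>) s) (X \<epsilon> s) \<le> \<xi>" "\<xi> \<le> max (left_lim (X \<epsilon>) s) (X \<epsilon> s)"
        "diff_quotient f f' (left_lim (X \<epsilon>) s) (X \<epsilon> s) = f' \<xi>"
        by (rule f.diff_quotient_mean_value) (rule that)
      have "\<bar>\<xi>\<bar> \<le> r" using \<xi>(1,2) r(3)[of \<epsilon> s] r(4)[of \<epsilon> s] s elim by auto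
      moreover have "\<bar>\<xi> - left_lim (X \<epsilon>) s\<bar> \<le> \<bar>jump (X \<epsilon>) s\<bar>"
        using \<xi>(1,2) unfolding jump_def by auto
      ultimately show ?thesis using \<xi>(3) by auto
    qed

    have "\<bar>LS_integral (\<lambda>s. ?m s * indicator A s) (X \<epsilon>) t\<bar> = \<bar>\<Sum>s\<in>A. ?m s * jump (X \<epsilon>) s\<bar>"
      by (simp add: y.LS_integral_finite_set[OF A t0])
    also have "\<dots> \<le> (\<Sum>s\<in>A. \<bar>?m s * jump (X \<epsilon>) s\<bar>)" by (rule sum_abs)
    also have "\<dots> \<le> (\<Sum>s\<in>A. \<epsilon> * (2 * D * (K * \<bar>jump x s\<bar>)))"
    proof (rule sum_mono)
      fix s assume "s \<in> A"
      then have s: "s \<in> {0<..t}" using A by auto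
      obtain \<xi> where \<xi>: "\<bar>\<xi>\<bar> \<le> r" "?k s = f' \<xi> - f' (left_lim x s)" using k_mean[OF s] by blast
      have "\<bar>?k s\<bar> \<le> 2 * D"
        using D(2)[OF \<xi>(1)] D(2)[of "left_lim x s"] r(2)[of s] s unfolding \<xi>(2) by auto
      then have "\<bar>?v s\<bar> * (\<bar>?k s\<bar> * \<bar>jump (X \<epsilon>) s\<bar>) \<le> \<epsilon> * (2 * D * (K * \<bar>jump x s\<bar>))"
        using close[of \<epsilon> s] jumps[of \<epsilon> s] s elim D K by (intro mult_mono) auto
      then show "\<bar>?m s * jump (X \<epsilon>) s\<bar> \<le> \<epsilon> * (2 * D * (K * \<bar>jump x s\<bar>))"
        by (simp add: abs_mult mult.assoc)
    qed
    also have "\<dots> = \<epsilon> * S" unfolding S_def sum_distrib_left ..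
    finally have large: "\<bar>LS_integral (\<lambda>s. ?m s * indicator A s) (X \<epsilon>) t\<bar> \<le> \<epsilon> * S" .

    have "\<bar>LS_integral (\<lambda>s. ?m s - ?m s * indicator A s) (X \<epsilon>) t\<bar>
        \<le> tv_integral (\<lambda>s. \<bar>?m s - ?m s * indicator A s\<bar>) (X \<epsilon>) t"
      by (intro y.abs_LS_integral_le bounded_borel_diff m mA t0)
    also have "\<dots> \<le> tv_integral (\<lambda>s. \<eta> * \<bar>?v s\<bar>) (X \<epsilon>) t"
    proof (rule y.tv_integral_mono)
      fix s assume s: "s \<in> {0<..t}"
      show "\<bar>?m s - ?m s * indicator A s\<bar> \<le> \<eta> * \<bar>?v s\<bar>"
      proof (cases "s \<in> A")
        case False
        obtain \<xi> where \<xi>: "\<bar>\<xi>\<bar> \<le> r" "\<bar>\<xi> - left_lim (X \<epsilon>) s\<bar> \<le> \<bar>jump (X \<epsilon>) s\<bar>"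
          "?k s = f' \<xi> - f' (left_lim x s)" using k_mean[OF s] by blast
        have "\<bar>jump x s\<bar> \<le> \<delta>" using False s by (auto simp: A_def)
        then have "K * \<bar>jump x s\<bar> \<le> K * \<delta>" using K by (rule mult_left_mono)
        then have "\<bar>jump (X \<epsilon>) s\<bar> < d / 2" using jumps[of \<epsilon> s] s elim K\<delta> by auto
        then have "\<bar>\<xi> - left_lim x s\<bar> < d"
          using \<xi>(2) left_close[of \<epsilon> s] s elim by auto
        then have "\<bar>?k s\<bar> < \<eta>"
          using d(2)[of "left_lim x s" \<xi>] \<xi>(1) r(2)[of s] s unfolding \<xi>(3) dist_real_def
          by (auto simp: abs_le_iff)
        then have "\<bar>?v s\<bar> * \<bar>?k s\<bar> \<le> \<bar>?v s\<bar> * \<eta>" by (intro mult_left_mono) auto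
        then show ?thesis using False by (simp add: abs_mult mult.commute)
      qed (use \<eta> in simp)
    qed (intro bounded_borel_intros v m mA t0)+
    also have "\<dots> \<le> \<eta> * C"
      unfolding tv_integral_mult_left using bound elim \<eta> by (intro mult_left_mono) auto
    finally have small: "\<bar>LS_integral (\<lambda>s. ?m s - ?m s * indicator A s) (X \<epsilon>) t\<bar> \<le> \<eta> * C" .

    have "LS_integral (\<lambda>s. ?m s - ?m s * indicator A s) (X \<epsilon>) t =
        LS_integral ?m (X \<epsilon>) t - LS_integral (\<lambda>s. ?m s * indicator A s) (X \<epsilon>) t"
      by (rule y.LS_integral_diff[OF m mA t0])
    then show ?case using large small \<eta>C elim(1) unfolding dist_real_def by linarith
  qed
qed

end

theorem proposition1:
  fixes x :: "real \<Rightarrow> real" and X :: "real \<Rightarrow> real \<Rightarrow> real"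
    and f f' F :: "real \<Rightarrow> real" and t :: real
  assumes x_cadlag: "cadlag x"
    and x_jumps: "\<And>u. u > 0 \<Longrightarrow> (\<lambda>s. (jump x s)\<^sup>2) summable_on {0<..u}"
    and X_cadlag: "\<And>\<epsilon>. \<epsilon> > 0 \<Longrightarrow> cadlag (X \<epsilon>)"
    and X_close: "\<And>\<epsilon> s. \<epsilon> > 0 \<Longrightarrow> s \<ge> 0 \<Longrightarrow> \<bar>x s - X \<epsilon> s\<bar> \<le> \<epsilon>"
    and X_finite_variation: "\<And>\<epsilon>. \<epsilon> > 0 \<Longrightarrow> finite_variation (X \<epsilon>)"
    and bracket_limit:
      "\<And>C. compact C \<Longrightarrow> C \<subseteq> {0..} \<Longrightarrow>
        uniform_limit C (\<lambda>\<epsilon> u. 2 * LS_integral (\<lambda>s. x s - X \<epsilon> s) (X \<epsilon>) u)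
          (path_bracket X x) (at_right 0)"
    and variation_bound:
      "\<And>u. u > 0 \<Longrightarrow> bdd_above ((\<lambda>\<epsilon>. tv_integral (\<lambda>s. \<bar>x s - X \<epsilon> s\<bar>) (X \<epsilon>) u) ` {0<..})"
    and jump_bound: "\<exists>K. \<forall>u>0. \<forall>\<epsilon>>0. \<bar>jump (X \<epsilon>) u\<bar> \<le> K * \<bar>jump x u\<bar>"
    and f_C1: "\<And>u. (f has_real_derivative f' u) (at u)" "continuous_on UNIV f'"
    and F_antiderivative: "\<And>u. (F has_real_derivative f u) (at u)"
    and t_pos: "t > 0"
  shows "((\<lambda>\<epsilon>. parts_integral f (X \<epsilon>) x t) \<longlongrightarrow> path_integral X f x t) (at_right 0) \<and>
    F (x t) - F (x 0) =
      path_integral X f x t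
      + 1/2 * LS_integral (\<lambda>s. f' (left_lim x s)) (path_bracket X x) t
      + (\<Sum>\<^sub>\<infinity>s\<in>{0<..t}. F (x s) - F (left_lim x s) - f (left_lim x s) * jump x s) \<and>
    \<comment> \<open>all terms involved are well defined\<close>
    (\<forall>\<epsilon>>0. LS_integrable (left_lim x) (\<lambda>s. f (X \<epsilon> s)) t \<and>
      (\<lambda>s. jump x s * (f (X \<epsilon> s) - f (left_lim (X \<epsilon>) s))) summable_on {0<..t}) \<and>
    LS_integrable (\<lambda>s. f' (left_lim x s)) (path_bracket X x) t \<and>
    (\<lambda>s. F (x s) - F (left_lim x s) - f (left_lim x s) * jump x s) summable_on {0<..t}"
proof -
  let ?B = "path_bracket X x"
  let ?v = "\<lambda>\<epsilon> s. x s - X \<epsilon> s"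
  have t0: "0 \<le> t" using t_pos by simp
  interpret f: C1_function f f' by unfold_locales (fact f_C1)+
  interpret C2_function F f f'
    by unfold_locales (fact F_antiderivative f.continuous)+
  have X: "finite_variation_path (X \<epsilon>)" if "\<epsilon> > 0" for \<epsilon>
    using X_cadlag X_finite_variation that by unfold_locales
  obtain K\<^sub>0 where K\<^sub>0: "\<And>u \<epsilon>. u > 0 \<Longrightarrow> \<epsilon> > 0 \<Longrightarrow> \<bar>jump (X \<epsilon>) u\<bar> \<le> K\<^sub>0 * \<bar>jump x u\<bar>"
    using jump_bound by blast
  \<comment> \<open>A negative constant is possible when \<open>x\<close> is continuous.\<close>
  define K where "K = max K\<^sub>0 0"
  have K_jumps: "\<bar>jump (X \<epsilon>) s\<bar> \<le> K * \<bar>jump x s\<bar>" if "\<epsilon> > 0" "s > 0" for \<epsilon> s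
  proof -
    have "K\<^sub>0 * \<bar>jump x s\<bar> \<le> K * \<bar>jump x s\<bar>" by (intro mult_right_mono) (auto simp: K_def)
    with K\<^sub>0[OF that(2,1)] show ?thesis by linarith
  qed
  interpret approximated_path x X K
    by (rule approximated_path.intro[OF x_cadlag X X_close _ K_jumps]) (simp_all add: K_def)

  have v_bb: "bounded_borel u (?v \<epsilon>)" if "\<epsilon> > 0" for \<epsilon> u
    using that by (intro bounded_borel_cadlag cadlag_diff x X_cadlag)
  \<comment> \<open>The factor 2 of the bracket is carried by the integrand.\<close>
  have v2_bb: "bounded_borel u (\<lambda>s. 2 * ?v \<epsilon> s)" if "\<epsilon> > 0" for \<epsilon> u
    by (rule bounded_borel_mult[OF bounded_borel_const v_bb[OF that]])
  have bound: "\<exists>C. \<forall>\<epsilon>>0. tv_integral (\<lambda>s. \<bar>?v \<epsilon> s\<bar>) (X \<epsilon>) u \<le> C" if "u > 0" for u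
    using variation_bound[OF that] by (auto simp: bdd_above_def)
  have bound2: "\<exists>C. \<forall>\<epsilon>>0. tv_integral (\<lambda>s. \<bar>2 * ?v \<epsilon> s\<bar>) (X \<epsilon>) u \<le> C" if u: "u > 0" for u
  proof -
    obtain C where "\<forall>\<epsilon>>0. tv_integral (\<lambda>s. \<bar>?v \<epsilon> s\<bar>) (X \<epsilon>) u \<le> C" using bound[OF u] by blast
    then show ?thesis
      by (intro exI[of _ "2 * C"]) (simp only: abs_mult abs_numeral tv_integral_mult_left, simp)
  qed
  have bracket: "uniform_limit {0..u} (\<lambda>\<epsilon>. LS_integral (\<lambda>s. 2 * ?v \<epsilon> s) (X \<epsilon>)) ?B (at_right 0)" for u
  proof -
    have "(\<lambda>\<epsilon> u. 2 * LS_integral (?v \<epsilon>) (X \<epsilon>) u) = (\<lambda>\<epsilon>. LS_integral (\<lambda>s. 2 * ?v \<epsilon> s) (X \<epsilon>))"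
      by (intro ext) (simp only: LS_integral_mult_left)
    with bracket_limit[of "{0..u}"] show ?thesis by simp
  qed
  have B: "finite_variation_path ?B"
    by (rule finite_variation_path_limit[OF X v2_bb bound2 bracket])
  interpret B: finite_variation_path ?B by fact

  let ?w = "\<lambda>s. f' (x s)"
  have w: "cadlag ?w" by (rule cadlag_compose[OF f.cont x])
  have left_w: "left_lim ?w s = f' (left_lim x s)" if "s \<in> {0<..t}" for s
    using left_lim_compose[OF f.cont x] that by simp
  have f'x_bb: "bounded_borel t (\<lambda>s. f' (left_lim x s))"
    using bounded_borel_cadlag(2)[OF w] by (rule iffD1[OF bounded_borel_cong, rotated]) (simp add: left_w)
  have B_integrable: "LS_integrable (\<lambda>s. f' (left_lim x s)) ?B t"
    unfolding LS_integrable_def tv_measure_def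
    by (intro conjI B.cadlag B.finite_variation set_integrable_stieltjes B.rc f'x_bb t0)

  obtain C\<^sub>2 where C\<^sub>2: "\<And>\<epsilon>. \<epsilon> > 0 \<Longrightarrow> tv_integral (\<lambda>s. \<bar>2 * ?v \<epsilon> s\<bar>) (X \<epsilon>) t \<le> C\<^sub>2"
    using bound2[OF t_pos] by blast
  have "((\<lambda>\<epsilon>. LS_integral (\<lambda>s. (2 * ?v \<epsilon> s) * left_lim ?w s) (X \<epsilon>) t) \<longlongrightarrow> LS_integral (left_lim ?w) ?B t) (at_right 0)"
    by (rule LS_integral_limit[OF X v2_bb C\<^sub>2 B _ w t_pos])
       (assumption+, rule tendsto_uniform_limitI[OF bracket])
  moreover have "LS_integral (left_lim ?w) ?B t = LS_integral (\<lambda>s. f' (left_lim x s)) ?B t"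
    by (rule LS_integral_cong) (rule left_w)
  moreover have "LS_integral (\<lambda>s. (2 * ?v \<epsilon> s) * left_lim ?w s) (X \<epsilon>) t =
      2 * LS_integral (\<lambda>s. ?v \<epsilon> s * f' (left_lim x s)) (X \<epsilon>) t" for \<epsilon>
    unfolding LS_integral_mult_left[symmetric] by (rule LS_integral_cong) (simp add: left_w)
  ultimately have "((\<lambda>\<epsilon>. 1/2 * (2 * LS_integral (\<lambda>s. ?v \<epsilon> s * f' (left_lim x s)) (X \<epsilon>) t)) \<longlongrightarrow>
      1/2 * LS_integral (\<lambda>s. f' (left_lim x s)) ?B t) (at_right 0)"
    by (intro tendsto_mult tendsto_const) simp
  then have bracket_term: "((\<lambda>\<epsilon>. LS_integral (\<lambda>s. ?v \<epsilon> s * f' (left_lim x s)) (X \<epsilon>) t) \<longlongrightarrow>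
      1/2 * LS_integral (\<lambda>s. f' (left_lim x s)) ?B t) (at_right 0)"
    by simp
  let ?q = "\<lambda>\<epsilon> s. diff_quotient f f' (left_lim (X \<epsilon>) s) (X \<epsilon> s)"
  obtain C where C: "\<And>\<epsilon>. \<epsilon> > 0 \<Longrightarrow> tv_integral (\<lambda>s. \<bar>?v \<epsilon> s\<bar>) (X \<epsilon>) t \<le> C"
    using bound[OF t_pos] by blast
  note remainder = remainder_tendsto_0[OF f.C1_function_axioms t_pos C]

  let ?J = "\<lambda>y s. F (y s) - F (left_lim y s) - f (left_lim y s) * jump y s"
  obtain r where r: "\<And>s. 0 \<le> s \<Longrightarrow> s \<le> t \<Longrightarrow> \<bar>x s\<bar> \<le> r" "\<And>s. 0 < s \<Longrightarrow> s \<le> t \<Longrightarrow> \<bar>left_lim x s\<bar> \<le> r"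
    "\<And>\<epsilon> s. 0 < \<epsilon> \<Longrightarrow> \<epsilon> < 1 \<Longrightarrow> 0 \<le> s \<Longrightarrow> s \<le> t \<Longrightarrow> \<bar>X \<epsilon> s\<bar> \<le> r"
    "\<And>\<epsilon> s. 0 < \<epsilon> \<Longrightarrow> \<epsilon> < 1 \<Longrightarrow> 0 < s \<Longrightarrow> s \<le> t \<Longrightarrow> \<bar>left_lim (X \<epsilon>) s\<bar> \<le> r"
    by (rule uniform_bound) (rule that)
  obtain D where D: "D \<ge> 0" "\<And>a b. \<bar>a\<bar> \<le> r \<Longrightarrow> \<bar>b\<bar> \<le> r \<Longrightarrow> \<bar>diff_quotient F f a b - f a\<bar> \<le> D * \<bar>b - a\<bar>"
    by (rule diff_quotient_expansion) (rule that)
  have J_bound: "\<bar>?J (X \<epsilon>) s\<bar> \<le> D * K\<^sup>2 * (jump x s)\<^sup>2" if \<epsilon>: "\<epsilon> \<in> {0<..<1}" and s: "s \<in> {0<..t}" for \<epsilon> s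
  proof -
    have "\<bar>?J (X \<epsilon>) s\<bar> = \<bar>diff_quotient F f (left_lim (X \<epsilon>) s) (X \<epsilon> s) - f (left_lim (X \<epsilon>) s)\<bar> * \<bar>jump (X \<epsilon>) s\<bar>"
      by (simp only: taylor_remainder_eq[symmetric] abs_mult)
    also have "\<dots> \<le> (D * \<bar>jump (X \<epsilon>) s\<bar>) * \<bar>jump (X \<epsilon>) s\<bar>"
      unfolding jump_def using \<epsilon> s by (intro mult_right_mono D r) auto
    also have "\<dots> = D * \<bar>jump (X \<epsilon>) s\<bar>\<^sup>2" by (simp add: power2_eq_square mult_ac)
    also have "\<dots> \<le> D * (K * \<bar>jump x s\<bar>)\<^sup>2"
      using jumps[of \<epsilon> s] \<epsilon> s D by (intro mult_left_mono power_mono) auto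
    finally show ?thesis by (simp add: power_mult_distrib)
  qed
  have J_lim: "((\<lambda>\<epsilon>. ?J (X \<epsilon>) s) \<longlongrightarrow> ?J x s) (at_right 0)" if "s \<in> {0<..t}" for s
  proof -
    have s: "0 \<le> s" "0 < s" using that by auto
    have iso: "isCont F u" "isCont f u" for u
      using F.continuous f.continuous by (simp_all add: continuous_on_eq_continuous_at)
    show ?thesis
      unfolding jump_def
      by (intro tendsto_diff tendsto_mult isCont_tendsto_compose[OF iso(1)] isCont_tendsto_compose[OF iso(2)]
          X_tendsto X_left_tendsto s)
  qed
  have Y: "\<forall>\<^sub>F \<epsilon> in at_right 0. \<epsilon> \<in> {0<..<1::real}"
    by (rule eventually_at_right_real) simp
  have g: "(\<lambda>s. D * K\<^sup>2 * (jump x s)\<^sup>2) summable_on {0<..t}"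
    by (rule summable_on_cmult_right[OF x_jumps[OF t_pos]])
  note J = infsum_dominated_convergence[where h = "\<lambda>\<epsilon>. ?J (X \<epsilon>)" and k = "?J x", OF g J_bound J_lim Y trivial_limit_at_right_real]

  \<comment> \<open>The limit, with the vanishing terms kept in the shape in which they arise.\<close>
  let ?L = "F (x t) - F (x 0) + (f (x t) * (x t - x t) - f (x 0) * (x 0 - x 0))
      - (0 + 1/2 * LS_integral (\<lambda>s. f' (left_lim x s)) ?B t) - (\<Sum>\<^sub>\<infinity>s\<in>{0<..t}. ?J x s)"
  have "((\<lambda>\<epsilon>. F (X \<epsilon> t) - F (X \<epsilon> 0) + (f (X \<epsilon> t) * (x t - X \<epsilon> t) - f (X \<epsilon> 0) * (x 0 - X \<epsilon> 0))
      - (LS_integral (\<lambda>s. ?v \<epsilon> s * (?q \<epsilon> s - f' (left_lim x s))) (X \<epsilon>) t +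
         LS_integral (\<lambda>s. ?v \<epsilon> s * f' (left_lim x s)) (X \<epsilon>) t)
      - (\<Sum>\<^sub>\<infinity>s\<in>{0<..t}. ?J (X \<epsilon>) s)) \<longlongrightarrow> ?L) (at_right 0)"
  proof -
    have iso: "isCont F u" "isCont f u" for u
      using F.continuous f.continuous by (simp_all add: continuous_on_eq_continuous_at)
    show ?thesis
      by (intro tendsto_diff tendsto_add tendsto_mult isCont_tendsto_compose[OF iso(1)]
          isCont_tendsto_compose[OF iso(2)] X_tendsto tendsto_const remainder bracket_term J(1) t0 order_refl)
  qed
  moreover have "\<forall>\<^sub>F \<epsilon> in at_right 0.
      F (X \<epsilon> t) - F (X \<epsilon> 0) + (f (X \<epsilon> t) * (x t - X \<epsilon> t) - f (X \<epsilon> 0) * (x 0 - X \<epsilon> 0))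
      - (LS_integral (\<lambda>s. ?v \<epsilon> s * (?q \<epsilon> s - f' (left_lim x s))) (X \<epsilon>) t +
         LS_integral (\<lambda>s. ?v \<epsilon> s * f' (left_lim x s)) (X \<epsilon>) t)
      - (\<Sum>\<^sub>\<infinity>s\<in>{0<..t}. ?J (X \<epsilon>) s) = parts_integral f (X \<epsilon>) x t"
    using eventually_at_right_less[of "0::real"]
  proof eventually_elim
    case (elim \<epsilon>)
    interpret y: finite_variation_path "X \<epsilon>" by (rule X[OF elim])
    have "LS_integral (\<lambda>s. ?v \<epsilon> s * (?q \<epsilon> s - f' (left_lim x s))) (X \<epsilon>) t +
         LS_integral (\<lambda>s. ?v \<epsilon> s * f' (left_lim x s)) (X \<epsilon>) t =
        LS_integral (\<lambda>s. ?v \<epsilon> s * (?q \<epsilon> s - f' (left_lim x s)) + ?v \<epsilon> s * f' (left_lim x s)) (X \<epsilon>) t"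
      by (intro y.LS_integral_add[symmetric] bounded_borel_mult bounded_borel_diff v_bb elim f'x_bb
          f.bounded_borel_diff_quotient y.cadlag t_pos t0)
    also have "\<dots> = LS_integral (\<lambda>s. ?v \<epsilon> s * ?q \<epsilon> s) (X \<epsilon>) t"
      by (rule LS_integral_cong) (simp add: right_diff_distrib)
    finally show ?case
      using parts_integral_formula(1)[OF X[OF elim] x t_pos] by simp
  qed
  ultimately have limit: "((\<lambda>\<epsilon>. parts_integral f (X \<epsilon>) x t) \<longlongrightarrow> ?L) (at_right 0)"
    by (rule Lim_transform_eventually)
  then have "path_integral X f x t = ?L"
    unfolding path_integral_def by (intro tendsto_Lim) simp_all
  moreover have "LS_integrable (left_lim x) (\<lambda>s. f (X \<epsilon> s)) t"
    "(\<lambda>s. jump x s * (f (X \<epsilon> s) - f (left_lim (X \<epsilon>) s))) summable_on {0<..t}" if "\<epsilon> > 0" for \<epsilon>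
    by (rule parts_integral_formula[OF X[OF that] x t_pos])+
  ultimately show ?thesis
    using limit B_integrable J(2) by simp
qed

end
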